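(* Let $d=1$, $m>1$ and $x_0\in\mathbb R$. Let $$u(t,x):=t^{-\alpha}\big(C-k|(x-x_0)t^{-\alpha}|^2\big)_+^{\frac1{m-1}},\qquad(t,x)\in(0,\infty)\times\mathbb R,$$ with $\alpha=\frac1{m+1}$, $k=\frac{\alpha(m-1)}{2m}$ and $C\in(0,\infty)$ the constant for which $\int_{\mathbb R}u(t,x)\,dx=1$ for all $t>0$, be the Barenblatt solution of $\partial_tu-\partial_x^2(|u|^{m-1}u)=0$, $u|_{t=0}=\delta_{x_0}$. Let $T\in(0,\infty)$. Suppose $(X,W)$, $(Y,W)$ are two $P^{(u_t)}_{\delta_{x_0}}$-weak solutions up to time $T$ to $$dX(t)=\sqrt{2\Big|\tfrac{d\mathcal L_{X(t)}}{dx}(X(t))\Big|^{m-1}}\,dW(t),\qquad t\in[0,T],\qquad X(0)=x_0,$$ on a common stochastic basis $(\Omega,\mathcal F,\mathbb P;(\mathcal F_t)_{t\in[0,T]})$ with respect to the same standard one-dimensional $(\mathcal F_t)$-Brownian motion $W$, such that $X(0)=Y(0)$ $\mathbb P$-a.s. Then $\sup_{t\in[0,T]}|X(t)-Y(t)|=0$ $\mathbb P$-a.s.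
   Context: Write $u_t=u(t,\cdot)$ and $(\cdot)_+=\max(\cdot,0)$. $\mathcal L_{X(t)}$ is the law of $X(t)$. For a Borel probability measure $\mu$ on $\mathbb R$, $\frac{d\mu}{dx}(x)$ is understood as the density of the absolutely continuous part in the following version: it equals $\lim_{R\to0}\mu(B_R(x))/\lambda(B_R(0))$ if this limit exists in $\mathbb R$, and $0$ otherwise. A stochastic basis is a complete filtered probability space with a normal filtration (right-continuous and containing all null sets). A $P^{(u_t)}_{\delta_{x_0}}$-weak solution up to time $T$ is a probabilistically weak solution $(X,W)$ of the SDE on some stochastic basis ($X$ continuous and adapted, $W$ a standard one-dimensional $(\mathcal F_t)$-Brownian motion) with $\mathcal L_{X(0)}=\delta_{x_0}$ and $\mathcal L_{X(t)}=u_t(x)dx$ for all $t\in(0,T]$. *)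

theory Defs
  imports "HOL-Probability.Probability"
begin

text \<open>Time is a real number; all processes and filtrations are only constrained on \<open>[0, T]\<close>.\<close>

locale stochastic_basis = prob_space M + complete_measure M
  for M :: "'a measure" and F :: "real \<Rightarrow> 'a measure" and T :: real +
  assumes subalgebra: "\<And>t. t \<in> {0..T} \<Longrightarrow> subalgebra M (F t)"
    and filtration_mono: "\<And>s t. 0 \<le> s \<Longrightarrow> s \<le> t \<Longrightarrow> t \<le> T \<Longrightarrow> sets (F s) \<subseteq> sets (F t)"
    and right_continuous: "\<And>t. t \<in> {0..<T} \<Longrightarrow> sets (F t) = (\<Inter>s\<in>{t<..T}. sets (F s))"
    and null_sets_initial: "null_sets M \<subseteq> sets (F 0)"

definition adapted :: "(real \<Rightarrow> 'a measure) \<Rightarrow> real \<Rightarrow> (real \<Rightarrow> 'a \<Rightarrow> real) \<Rightarrow> bool" where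
  "adapted F T X \<longleftrightarrow> (\<forall>t\<in>{0..T}. X t \<in> borel_measurable (F t))"

definition progressive :: "(real \<Rightarrow> 'a measure) \<Rightarrow> real \<Rightarrow> (real \<Rightarrow> 'a \<Rightarrow> real) \<Rightarrow> bool" where
  "progressive F T H \<longleftrightarrow>
     (\<forall>t\<in>{0..T}. (\<lambda>(s, \<omega>). H s \<omega>) \<in> borel_measurable (restrict_space borel {0..t} \<Otimes>\<^sub>M F t))"

definition continuous_paths :: "'a measure \<Rightarrow> real \<Rightarrow> (real \<Rightarrow> 'a \<Rightarrow> real) \<Rightarrow> bool" where
  "continuous_paths M T X \<longleftrightarrow> (\<forall>\<omega>\<in>space M. continuous_on {0..T} (\<lambda>t. X t \<omega>))"

locale brownian_motion = stochastic_basis M F T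
  for M :: "'a measure" and F :: "real \<Rightarrow> 'a measure" and T :: real +
  fixes W :: "real \<Rightarrow> 'a \<Rightarrow> real"
  assumes adapted: "adapted F T W"
    and continuous_paths: "continuous_paths M T W"
    and start_zero: "AE \<omega> in M. W 0 \<omega> = 0"
    and increment_indep: "\<And>s t. 0 \<le> s \<Longrightarrow> s < t \<Longrightarrow> t \<le> T \<Longrightarrow>
      indep_set (sets (F s)) (sets (vimage_algebra (space M) (\<lambda>\<omega>. W t \<omega> - W s \<omega>) borel))"
    and increment_normal: "\<And>s t. 0 \<le> s \<Longrightarrow> s < t \<Longrightarrow> t \<le> T \<Longrightarrow>
      distributed M lborel (\<lambda>\<omega>. W t \<omega> - W s \<omega>) (\<lambda>x. ennreal (normal_density 0 (sqrt (t - s)) x))"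


subsection \<open>The It\^o integral\<close>

text \<open>
  A simple integrand is \<open>\<Sum>i<n. \<xi> i * indicator {\<tau> i<..\<tau> (Suc i)}\<close> with deterministic times and
  bounded \<open>F (\<tau> i)\<close>-measurable \<open>\<xi> i\<close>.
\<close>

definition simple_integrand ::
  "'a measure \<Rightarrow> (real \<Rightarrow> 'a measure) \<Rightarrow> real \<Rightarrow> nat \<Rightarrow> (nat \<Rightarrow> real) \<Rightarrow> (nat \<Rightarrow> 'a \<Rightarrow> real) \<Rightarrow> bool" where
  "simple_integrand M F T n \<tau> \<xi> \<longleftrightarrow>
     (\<forall>i<n. 0 \<le> \<tau> i \<and> \<tau> i \<le> \<tau> (Suc i) \<and> \<tau> (Suc i) \<le> T \<and> \<xi> i \<in> borel_measurable (F (\<tau> i)) \<and>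
        (\<exists>B. \<forall>\<omega>\<in>space M. \<bar>\<xi> i \<omega>\<bar> \<le> B))"

definition simple_process :: "nat \<Rightarrow> (nat \<Rightarrow> real) \<Rightarrow> (nat \<Rightarrow> 'a \<Rightarrow> real) \<Rightarrow> real \<Rightarrow> 'a \<Rightarrow> real" where
  "simple_process n \<tau> \<xi> t \<omega> = (\<Sum>i<n. \<xi> i \<omega> * indicator {\<tau> i<..\<tau> (Suc i)} t)"

definition simple_integral ::
  "(real \<Rightarrow> 'a \<Rightarrow> real) \<Rightarrow> nat \<Rightarrow> (nat \<Rightarrow> real) \<Rightarrow> (nat \<Rightarrow> 'a \<Rightarrow> real) \<Rightarrow> real \<Rightarrow> 'a \<Rightarrow> real" where
  "simple_integral W n \<tau> \<xi> t \<omega> = (\<Sum>i<n. \<xi> i \<omega> * (W (min t (\<tau> (Suc i))) \<omega> - W (min t (\<tau> i)) \<omega>))"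

text \<open>
  \<open>has_ito_integral M F T W H I\<close>: the continuous adapted process \<open>I\<close> is a version of
  \<open>t \<mapsto> \<integral>\<^sub>0\<^sup>t H dW\<close> on \<open>[0, T]\<close>, where \<open>H\<close> is progressively measurable and almost surely square
  integrable in time: some simple integrands converge to \<open>H\<close> in \<open>L\<^sup>2([0, T])\<close> in probability, and
  their integrals converge to \<open>I\<close> uniformly on \<open>[0, T]\<close> in probability. This determines \<open>I\<close> up to
  indistinguishability. All events below are measurable, so that \<open>measure M\<close> is their probability.
\<close>

definition has_ito_integral ::
  "'a measure \<Rightarrow> (real \<Rightarrow> 'a measure) \<Rightarrow> real \<Rightarrow> (real \<Rightarrow> 'a \<Rightarrow> real) \<Rightarrow> (real \<Rightarrow> 'a \<Rightarrow> real) \<Rightarrow>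
   (real \<Rightarrow> 'a \<Rightarrow> real) \<Rightarrow> bool" where
  "has_ito_integral M F T W H I \<longleftrightarrow>
     progressive F T H \<and>
     (AE \<omega> in M. (\<integral>\<^sup>+s\<in>{0..T}. ennreal ((H s \<omega>)\<^sup>2) \<partial>lborel) < \<infinity>) \<and>
     adapted F T I \<and> continuous_paths M T I \<and>
     (\<exists>n \<tau> \<xi>.
        (\<forall>k. simple_integrand M F T (n k) (\<tau> k) (\<xi> k)) \<and>
        (\<forall>\<epsilon>>0. (\<lambda>k. measure M {\<omega>\<in>space M.
            (\<integral>\<^sup>+s\<in>{0..T}. ennreal ((simple_process (n k) (\<tau> k) (\<xi> k) s \<omega> - H s \<omega>)\<^sup>2) \<partial>lborel)
              > ennreal \<epsilon>}) \<longlonglongrightarrow> 0) \<and>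
        (\<forall>\<epsilon>>0. (\<lambda>k. measure M {\<omega>\<in>space M.
            (SUP t\<in>{0..T}. \<bar>simple_integral W (n k) (\<tau> k) (\<xi> k) t \<omega> - I t \<omega>\<bar>) > \<epsilon>}) \<longlonglongrightarrow> 0))"


subsection \<open>Weak solutions with prescribed one-dimensional marginals\<close>

text \<open>
  The pointwise version of the density of the absolutely continuous part of a measure on the line.
\<close>

definition ball_ratio :: "real measure \<Rightarrow> real \<Rightarrow> real \<Rightarrow> real" where
  "ball_ratio \<mu> x R = measure \<mu> (ball x R) / measure lborel (ball (0::real) R)"

definition lebesgue_density :: "real measure \<Rightarrow> real \<Rightarrow> real" where
  "lebesgue_density \<mu> x =
     (if \<exists>l. (ball_ratio \<mu> x \<longlongrightarrow> l) (at_right 0) then Lim (at_right 0) (ball_ratio \<mu> x) else 0)"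

text \<open>
  A \<open>P\<^bsup>(u\<^sub>t)\<^esup>\<close>-weak solution \<open>(X, W)\<close>, started in \<open>\<delta>\<close> at \<open>x0\<close>, of the driftless McKean--Vlasov
  equation \<open>dX(t) = \<sigma> (law of X(t)) (X(t)) dW(t)\<close>.
\<close>

locale weak_solution = brownian_motion M F T W
  for M :: "'a measure" and F :: "real \<Rightarrow> 'a measure" and T :: real and W :: "real \<Rightarrow> 'a \<Rightarrow> real" +
  fixes \<sigma> :: "real measure \<Rightarrow> real \<Rightarrow> real"
    and u :: "real \<Rightarrow> real \<Rightarrow> real" and x0 :: real
    and X :: "real \<Rightarrow> 'a \<Rightarrow> real"
  assumes solution_adapted: "adapted F T X"
    and solution_continuous: "continuous_paths M T X"
    and initial_law: "distr M borel (X 0) = return borel x0"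
    and marginal_law: "\<And>t. t \<in> {0<..T} \<Longrightarrow> distributed M lborel (X t) (\<lambda>x. ennreal (u t x))"
    and equation: "\<exists>I. has_ito_integral M F T W (\<lambda>t \<omega>. \<sigma> (distr M borel (X t)) (X t \<omega>)) I \<and>
      (AE \<omega> in M. \<forall>t\<in>{0..T}. X t \<omega> = X 0 \<omega> + I t \<omega>)"

definition diffusion_coefficient :: "real \<Rightarrow> real measure \<Rightarrow> real \<Rightarrow> real" where
  "diffusion_coefficient m \<mu> x = sqrt (2 * \<bar>lebesgue_density \<mu> x\<bar> powr (m - 1))"

definition barenblatt :: "real \<Rightarrow> real \<Rightarrow> real \<Rightarrow> real \<Rightarrow> real \<Rightarrow> real" where
  "barenblatt m C x0 t x =
     (let \<alpha> = 1 / (m + 1); k = \<alpha> * (m - 1) / (2 * m)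
      in t powr (- \<alpha>) * (max (C - k * \<bar>(x - x0) * t powr (- \<alpha>)\<bar>\<^sup>2) 0) powr (1 / (m - 1)))"

end

theory Submission
  imports Defs
begin

text \<open>
  In the variable \<open>z = (x - x0) * t powr (-\<alpha>)\<close> the squared diffusion coefficient is
  \<open>2 * t powr (-\<alpha> * (m - 1)) * max (C - k * z\<^sup>2) 0\<close>. It is bounded by an integrable function of time and
  Lipschitz in \<open>x\<close> with constant \<open>K t\<close> proportional to \<open>t powr (-\<alpha> * m)\<close>, which is integrable since
  \<open>\<alpha> * m = m / (m + 1) < 1\<close>. Hence \<open>D = X - Y\<close> is an Ito integral \<open>\<integral> H dW\<close> with \<open>H\<^sup>2 \<le> K t * \<bar>D\<bar>\<close>, and the
  Yamada--Watanabe argument applies: if \<open>f''(x) = 1 / sqrt (x\<^sup>2 + d\<^sup>2)\<close> and \<open>f 0 = f' 0 = 0\<close>, then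
  \<open>E (f (D t)) \<le> 1/2 * E (\<integral> f''(D) * H\<^sup>2) \<le> 1/2 * \<integral> K\<close> for every \<open>d\<close>, whereas \<open>f\<close> tends to infinity off \<open>0\<close>
  as \<open>d\<close> tends to \<open>0\<close>.

  Ito's formula is only needed as an inequality for simple integrands, where it follows from a Taylor
  expansion: Gaussian increments over a time step \<open>h\<close> leave an error of order \<open>h powr (3/2)\<close>, which
  disappears on subdividing. To pass to the limit without moment bounds on the approximating simple
  integrands, these are switched off before their energy \<open>\<integral> H\<^sup>2\<close> exceeds a constant; on the event
  where they are close to the true integrand nothing is changed, and off this event the energy is
  still bounded by a constant.
\<close>

subsection \<open>A Yamada--Watanabe test function\<close>

text \<open>The cubic remainder matters because the third absolute moment of a Gaussian increment
  over a time step \<open>r\<close> is of order \<open>r powr (3/2)\<close>, which is summable to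
  zero under subdivision.\<close>

lemma taylor_third_order:
  fixes f :: "real \<Rightarrow> real"
  assumes f: "\<And>x. (f has_real_derivative f1 x) (at x)" "\<And>x. (f1 has_real_derivative f2 x) (at x)"
      "\<And>x. (f2 has_real_derivative f3 x) (at x)"
    and L: "\<And>x. \<bar>f3 x\<bar> \<le> L"
  shows "\<bar>f (a + h) - (f a + f1 a * h + f2 a / 2 * h\<^sup>2)\<bar> \<le> L / 6 * \<bar>h\<bar> ^ 3"
proof (cases "h = 0")
  case False
  define D where "D = (\<lambda>n::nat. if n = 0 then f else if n = 1 then f1 else if n = 2 then f2 else f3)"
  \<comment> \<open>The increment \<open>h\<close> may have either sign, so the interval is
    described by \<open>min\<close> and \<open>max\<close> of the two points.\<close>
  have "\<exists>t. (if a + h < a then a + h < t \<and> t < a else a < t \<and> t < a + h) \<and>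
      f (a + h) = (\<Sum>m<3. D m a / fact m * (a + h - a) ^ m) + D 3 t / fact 3 * (a + h - a) ^ 3"
    by (rule Taylor[where a = "min a (a + h)" and b = "max a (a + h)"])
      (use False f in \<open>auto simp: D_def less_Suc_eq numeral_2_eq_2 numeral_3_eq_3\<close>)
  then obtain t where "f (a + h) = (\<Sum>m<3. D m a / fact m * h ^ m) + D 3 t / fact 3 * h ^ 3"
    by auto
  then have "f (a + h) - (f a + f1 a * h + f2 a / 2 * h\<^sup>2) = f3 t / 6 * h ^ 3"
    by (simp add: D_def numeral_3_eq_3 numeral_2_eq_2 fact_numeral)
  also have "\<bar>\<dots>\<bar> \<le> L / 6 * \<bar>h\<bar> ^ 3"
    using L[of t] by (simp add: abs_mult power_abs mult_right_mono)
  finally show ?thesis .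
qed simp

text \<open>With \<open>N\<close> equal steps of length \<open>l / N\<close> the errors add up to
  \<open>C * l * sqrt (l / N)\<close>, which vanishes as \<open>N\<close> grows.\<close>

lemma telescoping_nonincreasing:
  fixes G :: "real \<Rightarrow> real"
  assumes "a \<le> b"
    and G: "\<And>s t. a \<le> s \<Longrightarrow> s < t \<Longrightarrow> t \<le> b \<Longrightarrow> G t - G s \<le> C * (t - s) * sqrt (t - s)"
  shows "G b \<le> G a"
proof (cases "a = b")
  case False
  with \<open>a \<le> b\<close> have ab: "a < b" by simp
  define l where "l = b - a"
  have l: "l > 0" using ab by (simp add: l_def)
  have "G b - G a \<le> C * l * sqrt (l / real (Suc n))" for n
  proof -
    define N where "N = Suc n"
    define h where "h = l / real N"
    have h: "h > 0" "real N * h = l" using l by (auto simp: h_def N_def)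
    have ind: "G (a + real j * h) - G a \<le> real j * (C * h * sqrt h)" if "j \<le> N" for j
      using that
    proof (induction j)
      case (Suc j)
      have "real (Suc j) * h \<le> real N * h"
        using Suc.prems h by (intro mult_right_mono) auto
      then have "a + real (Suc j) * h \<le> b"
        using h by (simp add: l_def)
      then have "G (a + real (Suc j) * h) - G (a + real j * h) \<le> C * h * sqrt h"
        using G[of "a + real j * h" "a + real (Suc j) * h"] h by (simp add: algebra_simps)
      with Suc show ?case by (simp add: algebra_simps)
    qed simp
    have "G b - G a \<le> real N * (C * h * sqrt h)"
      using ind[of N] h by (simp add: l_def)
    also have "\<dots> = C * l * sqrt h" using h by (simp add: algebra_simps)
    finally show ?thesis by (simp add: h_def N_def)
  qed
  moreover have "(\<lambda>n. C * l * sqrt (l / real (Suc n))) \<longlonglongrightarrow> C * l * sqrt 0"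
    by (intro tendsto_intros LIMSEQ_Suc[OF lim_const_over_n])
  ultimately have "G b - G a \<le> C * l * sqrt 0"
    by (intro LIMSEQ_le_const) auto
  then show ?thesis by simp
qed simp

text \<open>Exceptional points are excluded from the open interval only. Splitting at such a point
  turns it into an endpoint of both halves, so induction on the number of interior exceptional
  points reduces the claim to \<open>telescoping_nonincreasing\<close>.\<close>

lemma piecewise_nonincreasing:
  fixes G :: "real \<Rightarrow> real"
  assumes "finite P" "a \<le> b"
    and G: "\<And>s t. a \<le> s \<Longrightarrow> s < t \<Longrightarrow> t \<le> b \<Longrightarrow> P \<inter> {s<..<t} = {} \<Longrightarrow>
      G t - G s \<le> C * (t - s) * sqrt (t - s)"
  shows "G b \<le> G a"
  using assms(2,3)
proof (induction "card (P \<inter> {a<..<b})" arbitrary: a b rule: less_induct)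
  case less
  show ?case
  proof (cases "P \<inter> {a<..<b} = {}")
    case True
    show ?thesis
    proof (rule telescoping_nonincreasing[OF less.prems(1)])
      fix s t assume st: "a \<le> s" "s < t" "t \<le> b"
      then have "P \<inter> {s<..<t} \<subseteq> P \<inter> {a<..<b}" by auto
      with True st show "G t - G s \<le> C * (t - s) * sqrt (t - s)"
        by (intro less.prems(2)) auto
    qed
  next
    case False
    then obtain p where p: "p \<in> P" "a < p" "p < b" by auto
    have "card (P \<inter> {a<..<p}) < card (P \<inter> {a<..<b})" "card (P \<inter> {p<..<b}) < card (P \<inter> {a<..<b})"
      using p assms(1) by (auto intro!: psubset_card_mono)
    then have "G p \<le> G a" "G b \<le> G p"
      using p by (auto intro!: less.hyps less.prems(2))
    then show ?thesis by simp
  qed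
qed

section \<open>The test function, its derivatives and its growth\<close>

text \<open>
  Its second derivative \<open>1 / sqrt (x\<^sup>2 + d\<^sup>2)\<close> is at most \<open>1 / \<bar>x\<bar>\<close>, uniformly in \<open>d\<close>, but its integral over
  a neighbourhood of \<open>0\<close>, and with it \<open>yw d x\<close>, diverges as \<open>d\<close> tends to \<open>0\<close>.
\<close>

definition yw :: "real \<Rightarrow> real \<Rightarrow> real" where
  "yw d x = x * arsinh (x / d) - sqrt (x\<^sup>2 + d\<^sup>2) + d"

lemma yw_0: "d > 0 \<Longrightarrow> yw d 0 = 0"
  by (simp add: yw_def)

text \<open>This comes before \<open>yw_deriv1\<close> because the product rule there differentiates
  \<open>arsinh (x / d)\<close>.\<close>

lemma yw_deriv2:
  assumes "d > 0"
  shows "((\<lambda>x. arsinh (x / d)) has_real_derivative 1 / sqrt (x\<^sup>2 + d\<^sup>2)) (at x)"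
proof -
  have "sqrt ((x / d)\<^sup>2 + 1) = sqrt ((x\<^sup>2 + d\<^sup>2) / d\<^sup>2)"
    using assms by (simp add: field_simps power2_eq_square)
  also have "\<dots> = sqrt (x\<^sup>2 + d\<^sup>2) / d"
    using assms by (simp add: real_sqrt_divide)
  finally have eq: "sqrt ((x / d)\<^sup>2 + 1) = sqrt (x\<^sup>2 + d\<^sup>2) / d" .
  show ?thesis
    using DERIV_chain2[OF arsinh_real_has_field_derivative, of "\<lambda>x. x / d" "1 / d" x UNIV] assms
    by (simp add: eq DERIV_cdivide)
qed

lemma yw_deriv1:
  assumes "d > 0"
  shows "(yw d has_real_derivative arsinh (x / d)) (at x)"
proof -
  have pos: "x\<^sup>2 + d\<^sup>2 > 0" using assms by (simp add: sum_power2_gt_zero_iff)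
  \<comment> \<open>The second term of the product rule cancels against the derivative of the square
    root.\<close>
  have "((\<lambda>x. x * arsinh (x / d) - sqrt (x\<^sup>2 + d\<^sup>2) + d) has_real_derivative
      (1 * arsinh (x / d) + 1 / sqrt (x\<^sup>2 + d\<^sup>2) * x - x / sqrt (x\<^sup>2 + d\<^sup>2) + 0)) (at x)"
    using pos by (auto intro!: DERIV_mult yw_deriv2[OF assms] derivative_eq_intros simp: field_simps)
  then show ?thesis by (simp add: yw_def[abs_def])
qed

lemma yw_deriv3:
  assumes "d > 0"
  shows "((\<lambda>x. 1 / sqrt (x\<^sup>2 + d\<^sup>2)) has_real_derivative - x / (sqrt (x\<^sup>2 + d\<^sup>2)) ^ 3) (at x)"
proof -
  have pos: "x\<^sup>2 + d\<^sup>2 > 0" using assms by (simp add: sum_power2_gt_zero_iff)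
  then have "sqrt (x\<^sup>2 + d\<^sup>2) > 0" by simp
  then show ?thesis
    using pos by (auto intro!: derivative_eq_intros simp: field_simps power3_eq_cube power2_eq_square)
qed

lemma sqrt_sum_squares_ge:
  fixes x d :: real
  assumes "d > 0"
  shows "d \<le> sqrt (x\<^sup>2 + d\<^sup>2)" "\<bar>x\<bar> \<le> sqrt (x\<^sup>2 + d\<^sup>2)" "0 < sqrt (x\<^sup>2 + d\<^sup>2)"
  using assms by (auto intro!: real_le_rsqrt add_nonneg_pos simp: sum_power2_gt_zero_iff)

text \<open>The last bound is uniform in \<open>d\<close> and is the one that pays for a squared
  integrand of size \<open>\<bar>x\<bar>\<close>. The bound \<open>1 / d\<close> is used only for
  errors that are made small after \<open>d\<close> has been fixed.\<close>

lemma yw_bound2: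
  assumes "d > 0"
  shows "0 \<le> 1 / sqrt (x\<^sup>2 + d\<^sup>2)" "1 / sqrt (x\<^sup>2 + d\<^sup>2) \<le> 1 / d" "\<bar>x\<bar> * (1 / sqrt (x\<^sup>2 + d\<^sup>2)) \<le> 1"
  using sqrt_sum_squares_ge[OF assms, of x] assms by (auto simp: field_simps)

lemma yw_bound3:
  assumes "d > 0"
  shows "\<bar>- x / (sqrt (x\<^sup>2 + d\<^sup>2)) ^ 3\<bar> \<le> 1 / d\<^sup>2"
proof -
  define r where "r = sqrt (x\<^sup>2 + d\<^sup>2)"
  have r: "d \<le> r" "\<bar>x\<bar> \<le> r" "0 < r"
    unfolding r_def using sqrt_sum_squares_ge[OF assms, of x] by auto
  have "\<bar>- x / r ^ 3\<bar> = (\<bar>x\<bar> / r) * (1 / r\<^sup>2)"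
    using r by (simp add: abs_mult power3_eq_cube power2_eq_square)
  also have "\<dots> \<le> 1 * (1 / d\<^sup>2)"
    using r assms by (intro mult_mono) (auto simp: field_simps power_mono)
  finally show ?thesis by (simp add: r_def)
qed

text \<open>The function is even and its derivative \<open>arsinh (x / d)\<close> is nonnegative for
  nonnegative \<open>x\<close>. This is the monotonicity behind a Markov inequality for
  \<open>yw d\<close>.\<close>

lemma yw_mono:
  assumes "d > 0" "0 \<le> y" "y \<le> \<bar>x\<bar>"
  shows "yw d y \<le> yw d x"
proof -
  have "yw d x = yw d \<bar>x\<bar>"
    by (simp add: yw_def abs_real_def)
  moreover have "yw d y \<le> yw d \<bar>x\<bar>"
  proof (rule DERIV_nonneg_imp_nondecreasing[OF assms(3)])
    fix z assume "y \<le> z"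
    then have "0 \<le> z / d" using assms by simp
    then have "arsinh 0 \<le> arsinh (z / d)"
      by (metis arsinh_real_strict_mono less_eq_real_def)
    then show "\<exists>D. DERIV (yw d) z :> D \<and> 0 \<le> D"
      using yw_deriv1[OF assms(1)] by fastforce
  qed
  ultimately show ?thesis by simp
qed

lemma yw_nonneg: "d > 0 \<Longrightarrow> 0 \<le> yw d x"
  using yw_mono[of d 0 x] by (simp add: yw_0)

text \<open>For fixed \<open>y\<close> the left-hand side tends to infinity like
  \<open>y * ln (1 / d)\<close> as \<open>d\<close> tends to \<open>0\<close>; this blow-up is what
  finally forces probabilities to vanish.\<close>

lemma yw_lower:
  assumes "d > 0" "y > 0"
  shows "y * (ln (y / d) - 1) \<le> yw d y"
proof -
  have "ln (y / d) \<le> arsinh (y / d)"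
    unfolding arsinh_real_def using assms
    by (subst ln_le_cancel_iff) (auto intro!: add_pos_nonneg)
  then have "y * ln (y / d) \<le> y * arsinh (y / d)" using assms by simp
  moreover have "sqrt (y\<^sup>2 + d\<^sup>2) \<le> y + d"
    using assms by (intro real_le_lsqrt) (auto simp: power2_eq_square algebra_simps)
  ultimately show ?thesis by (simp add: yw_def algebra_simps)
qed

subsection \<open>Ito's inequality for elementary integrals\<close>

text \<open>By continuity the process is a pointwise limit of processes that read it at grid times
  only. Time is clamped because nothing is assumed outside \<open>{0..T}\<close>.\<close>

lemma measurable_continuous_first:
  fixes f :: "real \<Rightarrow> 'a \<Rightarrow> real"
  assumes T: "0 \<le> T"
    and cont: "\<And>\<omega>. \<omega> \<in> space M \<Longrightarrow> continuous_on {0..T} (\<lambda>t. f t \<omega>)"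
    and meas: "\<And>t. t \<in> {0..T} \<Longrightarrow> f t \<in> borel_measurable M"
  shows "(\<lambda>(t, \<omega>). f (max 0 (min T t)) \<omega>) \<in> borel_measurable (lborel \<Otimes>\<^sub>M M)"
proof -
  define clamp where "clamp t = max 0 (min T t)" for t :: real
  have clamp: "clamp t \<in> {0..T}" for t using T by (auto simp: clamp_def)
  \<comment> \<open>Rounding down to multiples of \<open>1 / (n + 1)\<close> takes countably many
    values, so measurability at each fixed time is enough.\<close>
  define q where "q n t = real_of_int \<lfloor>real (Suc n) * t\<rfloor> / real (Suc n)" for n t
  have q: "(\<lambda>n. q n t) \<longlonglongrightarrow> t" for t
  proof (rule LIMSEQ_I)
    fix r :: real assume "r > 0"
    then obtain N where N: "1 / real (Suc N) < r" using nat_approx_posE by metis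
    have "norm (q n t - t) < r" if "n \<ge> N" for n
    proof -
      have "q n t - t = (real_of_int \<lfloor>real (Suc n) * t\<rfloor> - real (Suc n) * t) / real (Suc n)"
        by (simp add: q_def diff_divide_distrib del: of_nat_Suc)
      then have "\<bar>q n t - t\<bar> = \<bar>real_of_int \<lfloor>real (Suc n) * t\<rfloor> - real (Suc n) * t\<bar> / real (Suc n)"
        by (simp only: abs_divide abs_of_nat)
      also have "\<dots> \<le> 1 / real (Suc n)" by (intro divide_right_mono) linarith+
      also have "\<dots> \<le> 1 / real (Suc N)" using that by (simp add: field_simps)
      finally show ?thesis using N by simp
    qed
    then show "\<exists>no. \<forall>n\<ge>no. norm (q n t - t) < r" by blast
  qed
  have "(\<lambda>x. f (clamp (fst x)) (snd x)) \<in> borel_measurable (lborel \<Otimes>\<^sub>M M)"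
  proof (rule borel_measurable_LIMSEQ_metric[where f = "\<lambda>n (x :: real \<times> 'a). f (clamp (q n (fst x))) (snd x)"])
    fix n
    have "(\<lambda>x. (\<lambda>i::int. \<lambda>x. f (clamp (real_of_int i / real (Suc n))) (snd x))
        \<lfloor>real (Suc n) * fst x\<rfloor> x) \<in> borel_measurable (lborel \<Otimes>\<^sub>M M)"
    proof (rule measurable_compose_countable[where
          f = "\<lambda>i (x :: real \<times> 'a). f (clamp (real_of_int i / real (Suc n))) (snd x)" and g = "\<lambda>x :: real \<times> 'a. \<lfloor>real (Suc n) * fst x\<rfloor>"])
      fix i :: int
      note [measurable] = meas[OF clamp[of "real_of_int i / real (Suc n)"]]
      show "(\<lambda>x. f (clamp (real_of_int i / real (Suc n))) (snd x)) \<in> borel_measurable (lborel \<Otimes>\<^sub>M M)"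
        by measurable
    qed measurable
    then show "(\<lambda>x. f (clamp (q n (fst x))) (snd x)) \<in> borel_measurable (lborel \<Otimes>\<^sub>M M)"
      by (simp add: q_def)
  next
    fix x :: "real \<times> 'a" assume "x \<in> space (lborel \<Otimes>\<^sub>M M)"
    then have "snd x \<in> space M" by (auto simp: space_pair_measure)
    moreover have "(\<lambda>n. clamp (q n (fst x))) \<longlonglongrightarrow> clamp (fst x)"
      unfolding clamp_def by (intro tendsto_intros q)
    ultimately show "(\<lambda>n. f (clamp (q n (fst x))) (snd x)) \<longlonglongrightarrow> f (clamp (fst x)) (snd x)"
      by (rule continuous_on_tendsto_compose[OF cont]) (use clamp in auto)
  qed
  then show ?thesis by (simp add: clamp_def split_def)
qed

section \<open>Brownian increments: adaptedness, moments and independence\<close>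

context brownian_motion
begin

lemma filtration_measurable:
  assumes "f \<in> borel_measurable (F t)" "t \<in> {0..T}"
  shows "f \<in> borel_measurable M"
  using measurable_from_subalg[OF subalgebra[OF assms(2)] assms(1)] .

lemma filtration_measurable_mono:
  assumes "f \<in> borel_measurable (F s)" "0 \<le> s" "s \<le> t" "t \<le> T"
  shows "f \<in> borel_measurable (F t)"
proof (rule measurable_from_subalg[OF _ assms(1)])
  show "Conditional_Expectation.subalgebra (F t) (F s)"
    using subalgebra[of s] subalgebra[of t] filtration_mono[of s t] assms
    by (auto simp: subalgebra_def)
qed

lemma brownian_measurable [measurable (raw)]:
  "0 \<le> t \<Longrightarrow> t \<le> T \<Longrightarrow> W t \<in> borel_measurable M"
  using adapted filtration_measurable[of "W t" t] by (auto simp: adapted_def)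

lemma increment_moments:
  assumes st: "0 \<le> s" "s < t" "t \<le> T"
  shows "integrable M (\<lambda>\<omega>. (W t \<omega> - W s \<omega>) ^ k)" "integrable M (\<lambda>\<omega>. \<bar>W t \<omega> - W s \<omega>\<bar> ^ k)"
    and "expectation (\<lambda>\<omega>. W t \<omega> - W s \<omega>) = 0"
    and "expectation (\<lambda>\<omega>. (W t \<omega> - W s \<omega>)\<^sup>2) = t - s"
    and "expectation (\<lambda>\<omega>. \<bar>W t \<omega> - W s \<omega>\<bar>) \<le> sqrt (t - s)"
    and "expectation (\<lambda>\<omega>. \<bar>W t \<omega> - W s \<omega>\<bar> ^ 3) \<le> 2 * (t - s) * sqrt (t - s)"
proof -
  note D = increment_normal[OF st]
  define v where "v = sqrt (t - s)"
  have v: "v > 0" using st by (simp add: v_def)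
  have v2: "v\<^sup>2 = t - s" using st by (simp add: v_def)
  have nn: "\<And>x. 0 \<le> normal_density 0 v x" by simp
  note [simp] = v_def[symmetric]
  note moment = distributed_integral[OF D, unfolded v_def[symmetric], OF _ nn, symmetric]
  \<comment> \<open>Odd absolute moments of a centred Gaussian carry this factor. Only their order
    in \<open>t - s\<close> matters, so it is replaced by \<open>1\<close>.\<close>
  have c: "sqrt (2 / pi) \<le> 1" using pi_gt3 by simp
  show "integrable M (\<lambda>\<omega>. (W t \<omega> - W s \<omega>) ^ k)"
    using integrable_normal_moment[OF v, of 0 k] distributed_integrable[OF D, of "\<lambda>x. x ^ k"] by simp
  show "integrable M (\<lambda>\<omega>. \<bar>W t \<omega> - W s \<omega>\<bar> ^ k)"
    using integrable_normal_moment_abs[OF v, of 0 k] distributed_integrable[OF D, of "\<lambda>x. \<bar>x\<bar> ^ k"] by simp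
  show "expectation (\<lambda>\<omega>. W t \<omega> - W s \<omega>) = 0"
    using integral_normal_moment_odd[OF v, of 0 0] moment[of "\<lambda>x. x"] by simp
  show "expectation (\<lambda>\<omega>. (W t \<omega> - W s \<omega>)\<^sup>2) = t - s"
    using integral_normal_moment_even[OF v, of 0 1] moment[of "\<lambda>x. x ^ 2"] v v2
    by (simp add: fact_numeral)
  have "expectation (\<lambda>\<omega>. \<bar>W t \<omega> - W s \<omega>\<bar>) = v * sqrt (2 / pi)"
    using integral_normal_moment_abs_odd[OF v, of 0 0] moment[of "\<lambda>x. \<bar>x\<bar>"] by simp
  also have "\<dots> \<le> v * 1" using v c by (intro mult_left_mono) auto
  finally show "expectation (\<lambda>\<omega>. \<bar>W t \<omega> - W s \<omega>\<bar>) \<le> sqrt (t - s)" by simp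
  have "expectation (\<lambda>\<omega>. \<bar>W t \<omega> - W s \<omega>\<bar> ^ 3) = 2 * v ^ 3 * sqrt (2 / pi)"
    using integral_normal_moment_abs_odd[OF v, of 0 1] moment[of "\<lambda>x. \<bar>x\<bar> ^ 3"]
    by (simp add: numeral_3_eq_3 numeral_2_eq_2)
  also have "\<dots> \<le> 2 * v ^ 3 * 1" using v c by (intro mult_left_mono) auto
  also have "\<dots> = 2 * (t - s) * sqrt (t - s)" using v2 by (simp add: power3_eq_cube power2_eq_square)
  finally show "expectation (\<lambda>\<omega>. \<bar>W t \<omega> - W s \<omega>\<bar> ^ 3) \<le> 2 * (t - s) * sqrt (t - s)" .
qed

text \<open>The increment is independent of \<open>F s\<close>, hence of \<open>Z\<close>. For
  \<open>g\<close> the identity this makes the first-order Taylor term vanish in expectation; for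
  \<open>g\<close> the square it replaces the squared increment by \<open>t - s\<close>.\<close>

lemma increment_product:
  fixes Z :: "'a \<Rightarrow> real" and g :: "real \<Rightarrow> real"
  assumes st: "0 \<le> s" "s < t" "t \<le> T"
    and Z: "Z \<in> borel_measurable (F s)" "integrable M Z"
    and g [measurable]: "g \<in> borel_measurable borel" and gi: "integrable M (\<lambda>\<omega>. g (W t \<omega> - W s \<omega>))"
  shows "integrable M (\<lambda>\<omega>. Z \<omega> * g (W t \<omega> - W s \<omega>))"
    and "expectation (\<lambda>\<omega>. Z \<omega> * g (W t \<omega> - W s \<omega>)) = expectation Z * expectation (\<lambda>\<omega>. g (W t \<omega> - W s \<omega>))"
proof -
  have sub: "subalgebra M (F s)" using st by (intro subalgebra) auto
  have W [measurable]: "(\<lambda>\<omega>. W t \<omega> - W s \<omega>) \<in> borel_measurable M" using st by (intro borel_measurable_diff brownian_measurable) auto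
  \<comment> \<open>The sigma-algebra generated by \<open>Z\<close> lies in that of time
    \<open>s\<close>, so it inherits the independence assumed for \<open>F s\<close>.\<close>
  have 1: "sigma_sets (space M) {Z -` A \<inter> space M |A. A \<in> sets borel} \<subseteq> sets (F s)"
  proof -
    have "{Z -` A \<inter> space M |A. A \<in> sets borel} \<subseteq> sets (F s)"
      using measurable_sets[OF Z(1)] sub by (auto simp: subalgebra_def)
    then show ?thesis
      using sub sets.sigma_sets_subset[of _ "F s"] by (auto simp: subalgebra_def)
  qed
  have 2: "sigma_sets (space M) {(\<lambda>\<omega>. W t \<omega> - W s \<omega>) -` A \<inter> space M |A. A \<in> sets borel} =
      sets (vimage_algebra (space M) (\<lambda>\<omega>. W t \<omega> - W s \<omega>) borel)"
    by (simp add: sets_vimage_algebra)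
  have "indep_var borel Z borel (\<lambda>\<omega>. W t \<omega> - W s \<omega>)"
    unfolding indep_var_eq 2
  proof (intro conjI)
    show "indep_set (sigma_sets (space M) {Z -` A \<inter> space M |A. A \<in> sets borel})
       (sets (vimage_algebra (space M) (\<lambda>\<omega>. W t \<omega> - W s \<omega>) borel))"
      using increment_indep[OF st] unfolding indep_set_def
      by (rule indep_sets_mono_sets) (use 1 in \<open>auto split: bool.split\<close>)
  qed (use filtration_measurable[OF Z(1)] st in auto)
  then have "indep_var borel ((\<lambda>x. x) \<circ> Z) borel (g \<circ> (\<lambda>\<omega>. W t \<omega> - W s \<omega>))"
    by (rule indep_var_compose) auto
  then have ind: "indep_var borel Z borel (\<lambda>\<omega>. g (W t \<omega> - W s \<omega>))"
    by (simp add: comp_def)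
  show "integrable M (\<lambda>\<omega>. Z \<omega> * g (W t \<omega> - W s \<omega>))"
    by (rule indep_var_integrable[OF ind Z(2) gi])
  show "expectation (\<lambda>\<omega>. Z \<omega> * g (W t \<omega> - W s \<omega>)) = expectation Z * expectation (\<lambda>\<omega>. g (W t \<omega> - W s \<omega>))"
    by (rule indep_var_lebesgue_integral[OF ind Z(2) gi])
qed

section \<open>Elementary integrands together with their integrals\<close>

text \<open>
  The exceptional times \<open>P\<close> are not part of a fixed representation by steps, so differences of simple
  integrals need no common refinement of partitions.
\<close>

definition integral_off :: "real set \<Rightarrow> (real \<Rightarrow> 'a \<Rightarrow> real) \<Rightarrow> (real \<Rightarrow> 'a \<Rightarrow> real) \<Rightarrow> bool" where
  "integral_off P H J \<longleftrightarrow>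
     (\<forall>s t. 0 \<le> s \<longrightarrow> s < t \<longrightarrow> t \<le> T \<longrightarrow> P \<inter> {s<..<t} = {} \<longrightarrow>
        H t \<in> borel_measurable (F s) \<and> (\<forall>\<omega>\<in>space M. \<forall>r\<in>{s<..t}.
          H r \<omega> = H t \<omega> \<and> J r \<omega> = J s \<omega> + H t \<omega> * (W r \<omega> - W s \<omega>)))"

text \<open>Integrand and integral are carried as a pair, with properties that are stable under
  linear combinations. Square integrability of \<open>J\<close> makes test functions of quadratic
  growth integrable along it.\<close>

definition elementary :: "(real \<Rightarrow> 'a \<Rightarrow> real) \<Rightarrow> (real \<Rightarrow> 'a \<Rightarrow> real) \<Rightarrow> bool" where
  "elementary H J \<longleftrightarrow>
     (\<lambda>(t, \<omega>). H t \<omega>) \<in> borel_measurable (lborel \<Otimes>\<^sub>M M) \<and>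
     (\<exists>B. \<forall>\<omega>\<in>space M. \<forall>t. \<bar>H t \<omega>\<bar> \<le> B) \<and>
     (\<forall>t\<in>{0..T}. J t \<in> borel_measurable (F t) \<and> integrable M (\<lambda>\<omega>. (J t \<omega>)\<^sup>2)) \<and>
     (\<forall>\<omega>\<in>space M. J 0 \<omega> = 0 \<and> continuous_on {0..T} (\<lambda>t. J t \<omega>)) \<and>
     (\<exists>P. finite P \<and> integral_off P H J)"

lemma elementary_zero: "elementary (\<lambda>_ _. 0) (\<lambda>_ _. 0)"
  unfolding elementary_def integral_off_def by (intro conjI ballI exI[of _ 0] exI[of _ "{}"]) auto

lemma elementary_add_scaled:
  assumes 1: "elementary H1 J1" and 2: "elementary H2 J2"
  shows "elementary (\<lambda>t \<omega>. H1 t \<omega> + c * H2 t \<omega>) (\<lambda>t \<omega>. J1 t \<omega> + c * J2 t \<omega>)"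
proof -
  obtain B1 where B1: "\<forall>\<omega>\<in>space M. \<forall>t. \<bar>H1 t \<omega>\<bar> \<le> B1" using 1 unfolding elementary_def by blast
  obtain B2 where B2: "\<forall>\<omega>\<in>space M. \<forall>t. \<bar>H2 t \<omega>\<bar> \<le> B2" using 2 unfolding elementary_def by blast
  obtain P1 where P1: "finite P1" "integral_off P1 H1 J1" using 1 unfolding elementary_def by blast
  obtain P2 where P2: "finite P2" "integral_off P2 H2 J2" using 2 unfolding elementary_def by blast
  have Hm [measurable]: "(\<lambda>(t, \<omega>). H1 t \<omega>) \<in> borel_measurable (lborel \<Otimes>\<^sub>M M)"
      "(\<lambda>(t, \<omega>). H2 t \<omega>) \<in> borel_measurable (lborel \<Otimes>\<^sub>M M)"
    using 1 2 by (auto simp: elementary_def)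
  show ?thesis
    unfolding elementary_def
  proof (intro conjI ballI)
    show "(\<lambda>(t, \<omega>). H1 t \<omega> + c * H2 t \<omega>) \<in> borel_measurable (lborel \<Otimes>\<^sub>M M)"
      by measurable
    have "\<bar>H1 t \<omega> + c * H2 t \<omega>\<bar> \<le> B1 + \<bar>c\<bar> * B2" if "\<omega> \<in> space M" for \<omega> t
      by (rule order.trans[OF abs_triangle_ineq])
        (use B1 B2 that in \<open>auto simp: abs_mult intro!: add_mono mult_left_mono\<close>)
    then show "\<exists>B. \<forall>\<omega>\<in>space M. \<forall>t. \<bar>H1 t \<omega> + c * H2 t \<omega>\<bar> \<le> B" by blast
  next
    fix t assume t: "t \<in> {0..T}"
    then have J: "J1 t \<in> borel_measurable (F t)" "J2 t \<in> borel_measurable (F t)"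
      "integrable M (\<lambda>\<omega>. (J1 t \<omega>)\<^sup>2)" "integrable M (\<lambda>\<omega>. (J2 t \<omega>)\<^sup>2)"
      using 1 2 by (auto simp: elementary_def)
    note [measurable] = filtration_measurable[OF J(1) t] filtration_measurable[OF J(2) t]
    show "(\<lambda>\<omega>. J1 t \<omega> + c * J2 t \<omega>) \<in> borel_measurable (F t)"
      by (intro borel_measurable_add borel_measurable_times borel_measurable_const J)
    show "integrable M (\<lambda>\<omega>. (J1 t \<omega> + c * J2 t \<omega>)\<^sup>2)"
    proof (rule Bochner_Integration.integrable_bound)
      show "integrable M (\<lambda>\<omega>. 2 * (J1 t \<omega>)\<^sup>2 + 2 * c\<^sup>2 * (J2 t \<omega>)\<^sup>2)"
        using J by (intro Bochner_Integration.integrable_add integrable_mult_right) auto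
      \<comment> \<open>The right-hand side exceeds the left-hand side by
        \<open>(a - c * b)\<^sup>2\<close>.\<close>
      have "(a + c * b)\<^sup>2 \<le> 2 * a\<^sup>2 + 2 * c\<^sup>2 * b\<^sup>2" for a b :: real
        using zero_le_power2[of "a - c * b"] by (simp add: power2_eq_square algebra_simps)
      then show "AE \<omega> in M. norm ((J1 t \<omega> + c * J2 t \<omega>)\<^sup>2) \<le> norm (2 * (J1 t \<omega>)\<^sup>2 + 2 * c\<^sup>2 * (J2 t \<omega>)\<^sup>2)"
        by simp
    qed measurable
  next
    fix \<omega> assume w: "\<omega> \<in> space M"
    show "J1 0 \<omega> + c * J2 0 \<omega> = 0" "continuous_on {0..T} (\<lambda>t. J1 t \<omega> + c * J2 t \<omega>)"
      using 1 2 w by (auto simp: elementary_def intro!: continuous_intros)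
  next
    show "\<exists>P. finite P \<and> integral_off P (\<lambda>t \<omega>. H1 t \<omega> + c * H2 t \<omega>) (\<lambda>t \<omega>. J1 t \<omega> + c * J2 t \<omega>)"
      unfolding integral_off_def
    proof (intro exI[of _ "P1 \<union> P2"] conjI allI impI)
      fix s t assume st: "0 \<le> s" "s < t" "t \<le> T" "(P1 \<union> P2) \<inter> {s<..<t} = {}"
      then have e: "P1 \<inter> {s<..<t} = {}" "P2 \<inter> {s<..<t} = {}" by auto
      note p = P1(2)[unfolded integral_off_def, rule_format, OF st(1-3) e(1)]
        P2(2)[unfolded integral_off_def, rule_format, OF st(1-3) e(2)]
      show "(\<lambda>\<omega>. H1 t \<omega> + c * H2 t \<omega>) \<in> borel_measurable (F s)"
        using p by (intro borel_measurable_add borel_measurable_times borel_measurable_const) auto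
      show "\<forall>\<omega>\<in>space M. \<forall>r\<in>{s<..t}.
          H1 r \<omega> + c * H2 r \<omega> = H1 t \<omega> + c * H2 t \<omega> \<and>
          J1 r \<omega> + c * J2 r \<omega> = J1 s \<omega> + c * J2 s \<omega> + (H1 t \<omega> + c * H2 t \<omega>) * (W r \<omega> - W s \<omega>)"
      proof (intro ballI)
        fix \<omega> r assume "\<omega> \<in> space M" "r \<in> {s<..t}"
        with p[THEN conjunct2] have "H1 r \<omega> = H1 t \<omega>" "H2 r \<omega> = H2 t \<omega>"
          "J1 r \<omega> = J1 s \<omega> + H1 t \<omega> * (W r \<omega> - W s \<omega>)" "J2 r \<omega> = J2 s \<omega> + H2 t \<omega> * (W r \<omega> - W s \<omega>)"
          by blast+
        note eqs = this
        show "H1 r \<omega> + c * H2 r \<omega> = H1 t \<omega> + c * H2 t \<omega> \<and>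
          J1 r \<omega> + c * J2 r \<omega> = J1 s \<omega> + c * J2 s \<omega> + (H1 t \<omega> + c * H2 t \<omega>) * (W r \<omega> - W s \<omega>)"
          by (simp only: eqs) (simp add: algebra_simps)
      qed
    qed (use P1 P2 in auto)
  qed
qed

lemma elementary_single:
  assumes ab: "0 \<le> a" "a \<le> b" "b \<le> T" and xi: "\<xi> \<in> borel_measurable (F a)"
    and B: "\<And>\<omega>. \<omega> \<in> space M \<Longrightarrow> \<bar>\<xi> \<omega>\<bar> \<le> B"
  shows "elementary (\<lambda>t \<omega>. \<xi> \<omega> * indicator {a<..b} t) (\<lambda>t \<omega>. \<xi> \<omega> * (W (min t b) \<omega> - W (min t a) \<omega>))"
proof -
  have a: "a \<in> {0..T}" using ab by auto
  have xiM [measurable]: "\<xi> \<in> borel_measurable M" by (rule filtration_measurable[OF xi a])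
  have J0: "\<xi> \<omega> * (W (min t b) \<omega> - W (min t a) \<omega>) = 0" if "t \<le> a" for t \<omega>
    using that ab by (simp add: min_def)
  show ?thesis
    unfolding elementary_def
  proof (intro conjI ballI)
    show "(\<lambda>(t, \<omega>). \<xi> \<omega> * indicator {a<..b} t) \<in> borel_measurable (lborel \<Otimes>\<^sub>M M)" by measurable
    show "\<exists>B. \<forall>\<omega>\<in>space M. \<forall>t. \<bar>\<xi> \<omega> * indicator {a<..b} t\<bar> \<le> B"
      using B by (intro exI[of _ B]) (auto simp: indicator_def intro: order.trans[OF abs_ge_zero])
  next
    fix t assume t: "t \<in> {0..T}"
    have Wm: "W r \<in> borel_measurable (F t)" if "0 \<le> r" "r \<le> t" for r
      using that t adapted filtration_measurable_mono[of "W r" r t] by (auto simp: adapted_def)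
    show "(\<lambda>\<omega>. \<xi> \<omega> * (W (min t b) \<omega> - W (min t a) \<omega>)) \<in> borel_measurable (F t)"
    proof (cases "a \<le> t")
      case True
      then show ?thesis
        using t ab by (intro borel_measurable_times borel_measurable_diff Wm
            filtration_measurable_mono[OF xi]) auto
    next
      case False
      \<comment> \<open>Before time \<open>a\<close> the variable \<open>\<xi>\<close> need not be
        measurable, but there the integral vanishes identically.\<close>
      then have "min t a = t" "min t b = t" using ab by auto
      then show ?thesis by simp
    qed
    show "integrable M (\<lambda>\<omega>. (\<xi> \<omega> * (W (min t b) \<omega> - W (min t a) \<omega>))\<^sup>2)"
    proof (cases "min t a < min t b")
      case True
      then have i: "integrable M (\<lambda>\<omega>. (W (min t b) \<omega> - W (min t a) \<omega>)\<^sup>2)"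
        using t ab by (intro increment_moments) auto
      have [measurable]: "W (min t a) \<in> borel_measurable M" "W (min t b) \<in> borel_measurable M"
        using t ab by (auto intro!: brownian_measurable)
      have "\<bar>\<xi> \<omega> * x\<bar>\<^sup>2 \<le> B\<^sup>2 * x\<^sup>2" if "\<omega> \<in> space M" for x \<omega>
        using B[OF that] abs_le_square_iff[of "\<xi> \<omega>" B] by (auto simp: power_mult_distrib intro!: mult_right_mono)
      then show ?thesis
        by (intro Bochner_Integration.integrable_bound[OF integrable_mult_right[OF i, of "B\<^sup>2"]]) auto
    qed (use ab in \<open>simp add: min_def split: if_splits\<close>)
  next
    fix \<omega> assume w: "\<omega> \<in> space M"
    show "\<xi> \<omega> * (W (min 0 b) \<omega> - W (min 0 a) \<omega>) = 0" using J0[of 0 \<omega>] ab by simp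
    have W: "continuous_on {0..T} (\<lambda>t. W t \<omega>)" using continuous_paths w by (auto simp: continuous_paths_def)
    have "continuous_on {0..T} (\<lambda>t. W (min t c) \<omega>)" if "c \<in> {0..T}" for c
      by (rule continuous_on_compose2[OF W]) (use that in \<open>auto intro!: continuous_intros\<close>)
    then show "continuous_on {0..T} (\<lambda>t. \<xi> \<omega> * (W (min t b) \<omega> - W (min t a) \<omega>))"
      using ab by (intro continuous_intros) auto
  next
    show "\<exists>P. finite P \<and> integral_off P (\<lambda>t \<omega>. \<xi> \<omega> * indicator {a<..b} t)
        (\<lambda>t \<omega>. \<xi> \<omega> * (W (min t b) \<omega> - W (min t a) \<omega>))"
      unfolding integral_off_def
    proof (intro exI[of _ "{a, b}"] conjI allI impI)
      fix s t assume st: "0 \<le> s" "s < t" "t \<le> T" "{a, b} \<inter> {s<..<t} = {}"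
      \<comment> \<open>An interval whose interior avoids both jump times lies inside the step,
        before it or after it.\<close>
      then consider "a \<le> s" "t \<le> b" | "t \<le> a" | "b \<le> s" by fastforce
      then have "(\<lambda>\<omega>. \<xi> \<omega> * indicator {a<..b} t) \<in> borel_measurable (F s) \<and> (\<forall>\<omega>\<in>space M. \<forall>r\<in>{s<..t}.
          \<xi> \<omega> * indicator {a<..b} r = \<xi> \<omega> * indicator {a<..b} t \<and>
          \<xi> \<omega> * (W (min r b) \<omega> - W (min r a) \<omega>) = \<xi> \<omega> * (W (min s b) \<omega> - W (min s a) \<omega>) +
            \<xi> \<omega> * indicator {a<..b} t * (W r \<omega> - W s \<omega>))"
      proof cases
        case 1
        have "(\<lambda>\<omega>. \<xi> \<omega> * indicator {a<..b} t) \<in> borel_measurable (F s)"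
          using 1 st ab by (intro borel_measurable_times borel_measurable_const
              filtration_measurable_mono[OF xi]) auto
        with 1 st show ?thesis by (auto simp: algebra_simps)
      next
        case 2
        with st ab show ?thesis by (auto simp: J0)
      next
        case 3
        with st ab show ?thesis by (auto simp: min_def)
      qed
      then show "(\<lambda>\<omega>. \<xi> \<omega> * indicator {a<..b} t) \<in> borel_measurable (F s)"
        "\<forall>\<omega>\<in>space M. \<forall>r\<in>{s<..t}.
          \<xi> \<omega> * indicator {a<..b} r = \<xi> \<omega> * indicator {a<..b} t \<and>
          \<xi> \<omega> * (W (min r b) \<omega> - W (min r a) \<omega>) = \<xi> \<omega> * (W (min s b) \<omega> - W (min s a) \<omega>) +
            \<xi> \<omega> * indicator {a<..b} t * (W r \<omega> - W s \<omega>)"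
        by auto
    qed simp
  qed
qed

lemma elementary_simple:
  assumes "simple_integrand M F T n \<tau> \<xi>"
  shows "elementary (simple_process n \<tau> \<xi>) (simple_integral W n \<tau> \<xi>)"
proof -
  have "elementary (\<lambda>t \<omega>. \<Sum>i<k. \<xi> i \<omega> * indicator {\<tau> i<..\<tau> (Suc i)} t)
      (\<lambda>t \<omega>. \<Sum>i<k. \<xi> i \<omega> * (W (min t (\<tau> (Suc i))) \<omega> - W (min t (\<tau> i)) \<omega>))" if "k \<le> n" for k
    using that
  proof (induction k)
    case (Suc k)
    then obtain B where "\<forall>\<omega>\<in>space M. \<bar>\<xi> k \<omega>\<bar> \<le> B"
      using assms unfolding simple_integrand_def by (metis Suc_le_lessD)
    then have "elementary (\<lambda>t \<omega>. \<xi> k \<omega> * indicator {\<tau> k<..\<tau> (Suc k)} t)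
        (\<lambda>t \<omega>. \<xi> k \<omega> * (W (min t (\<tau> (Suc k))) \<omega> - W (min t (\<tau> k)) \<omega>))"
      using assms Suc.prems by (intro elementary_single) (auto simp: simple_integrand_def)
    from elementary_add_scaled[OF Suc.IH this, of 1] Suc.prems show ?case by simp
  qed (simp add: elementary_zero)
  from this[of n] show ?thesis
    by (simp add: simple_process_def[abs_def] simple_integral_def[abs_def])
qed

end

section \<open>Ito's inequality and the deviation estimate it gives\<close>

text \<open>The derivative bound is local: it may depend on the distance from \<open>a\<close> to
  \<open>b\<close>. This is how a linear bound on \<open>f1\<close> yields a quadratic one on
  \<open>f\<close>.\<close>

lemma derivative_bound_real:
  fixes f :: "real \<Rightarrow> real"
  assumes "\<And>x. (f has_real_derivative f' x) (at x)" "\<And>x. \<bar>x - a\<bar> \<le> \<bar>b - a\<bar> \<Longrightarrow> \<bar>f' x\<bar> \<le> L"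
  shows "\<bar>f b - f a\<bar> \<le> L * \<bar>b - a\<bar>"
proof -
  have "norm (f b - f a) \<le> L * norm (b - a)"
    by (rule field_differentiable_bound[of "cball a \<bar>b - a\<bar>" f f'])
      (use assms in \<open>auto simp: dist_real_def abs_minus_commute intro: has_field_derivative_at_within\<close>)
  then show ?thesis by simp
qed

context brownian_motion
begin

lemma elementary_clamp_measurable:
  assumes "0 \<le> T" "elementary H J"
  shows "(\<lambda>(t, \<omega>). J (max 0 (min T t)) \<omega>) \<in> borel_measurable (lborel \<Otimes>\<^sub>M M)"
proof (rule measurable_continuous_first[OF assms(1)])
  fix t assume t: "t \<in> {0..T}"
  with assms(2) have "J t \<in> borel_measurable (F t)" unfolding elementary_def by blast
  then show "J t \<in> borel_measurable M" using t by (rule filtration_measurable)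
qed (use assms(2) in \<open>simp add: elementary_def\<close>)

text \<open>Between exceptional times the integrand is frozen at a variable known at the left
  endpoint. Taylor's formula then compares the increment of the left-hand side with that of the
  right-hand side up to an error of order \<open>(r - s) * sqrt (r - s)\<close>, and
  \<open>piecewise_nonincreasing\<close> removes such errors.\<close>

lemma elementary_ito:
  fixes f f1 f2 f3 :: "real \<Rightarrow> real"
  assumes el: "elementary H J"
    and f: "\<And>x. (f has_real_derivative f1 x) (at x)" "\<And>x. (f1 has_real_derivative f2 x) (at x)"
      "\<And>x. (f2 has_real_derivative f3 x) (at x)"
    and A: "\<And>x. \<bar>f2 x\<bar> \<le> A" and L: "\<And>x. \<bar>f3 x\<bar> \<le> L"
    and f0: "f 0 = 0" "f1 0 = 0" and t: "0 \<le> t" "t \<le> T"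
  shows "integrable M (\<lambda>\<omega>. f (J t \<omega>))"
    and "expectation (\<lambda>\<omega>. f (J t \<omega>)) \<le>
      1 / 2 * (LINT s:{0<..t}|lborel. expectation (\<lambda>\<omega>. f2 (J s \<omega>) * (H s \<omega>)\<^sup>2))"
proof -
  obtain B where B0: "\<forall>\<omega>\<in>space M. \<forall>t. \<bar>H t \<omega>\<bar> \<le> B" using el unfolding elementary_def by blast
  obtain P where P: "finite P" "integral_off P H J" using el unfolding elementary_def by blast
  have B: "\<bar>H t \<omega>\<bar> \<le> B" if "\<omega> \<in> space M" for t \<omega> using B0 that by blast
  obtain \<omega>0 where "\<omega>0 \<in> space M" using not_empty by blast
  from B[OF this, of 0] have B_nonneg: "B \<ge> 0" by linarith
  have A_nonneg: "A \<ge> 0" and L_nonneg: "L \<ge> 0" using A[of 0] L[of 0] by linarith+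
  have JF: "J s \<in> borel_measurable (F s)" and Jsq: "integrable M (\<lambda>\<omega>. (J s \<omega>)\<^sup>2)" if "0 \<le> s" "s \<le> T" for s
    using that el by (auto simp: elementary_def)
  have JM: "J s \<in> borel_measurable M" if "0 \<le> s" "s \<le> T" for s
    using filtration_measurable[OF JF] that by auto
  have HM [measurable]: "(\<lambda>(t, \<omega>). H t \<omega>) \<in> borel_measurable (lborel \<Otimes>\<^sub>M M)"
    using el by (simp add: elementary_def)
  have f_meas [measurable]: "f \<in> borel_measurable borel" "f1 \<in> borel_measurable borel" "f2 \<in> borel_measurable borel"
    by (auto intro!: borel_measurable_continuous_onI continuous_at_imp_continuous_on
        DERIV_isCont[OF f(1)] DERIV_isCont[OF f(2)] DERIV_isCont[OF f(3)])
  have f1_bound: "\<bar>f1 x\<bar> \<le> A * \<bar>x\<bar>" for x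
    using derivative_bound_real[OF f(2), of 0 x A] A f0 by simp
  have f_bound: "\<bar>f x\<bar> \<le> A * x\<^sup>2" for x
  proof -
    have "\<bar>f1 y\<bar> \<le> A * \<bar>x\<bar>" if "\<bar>y\<bar> \<le> \<bar>x\<bar>" for y
      using f1_bound[of y] that A_nonneg by (meson mult_left_mono order.trans)
    then show ?thesis
      using derivative_bound_real[OF f(1), of 0 x "A * \<bar>x\<bar>"] f0 by (simp add: power2_eq_square abs_mult_self_eq mult.assoc)
  qed
  have f2_lip: "\<bar>f2 y - f2 x\<bar> \<le> L * \<bar>y - x\<bar>" for x y
    using derivative_bound_real[OF f(3), of x y L] L by simp
  have int_f: "integrable M (\<lambda>\<omega>. f (J s \<omega>))" if "0 \<le> s" "s \<le> T" for s
    by (rule Bochner_Integration.integrable_bound[OF integrable_mult_right[OF Jsq[OF that], of A]])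
      (use that JM[OF that] f_bound A_nonneg in auto)
  show "integrable M (\<lambda>\<omega>. f (J t \<omega>))" by (rule int_f[OF t])

  define g where "g s = expectation (\<lambda>\<omega>. f2 (J (max 0 (min T s)) \<omega>) * (H s \<omega>)\<^sup>2)" for s
  have T: "0 \<le> T" using t by simp
  note [measurable] = elementary_clamp_measurable[OF T el]
  have g_meas [measurable]: "g \<in> borel_measurable lborel"
    unfolding g_def by measurable
  have bound2: "\<bar>f2 x * (H s \<omega>)\<^sup>2\<bar> \<le> A * B\<^sup>2" if "\<omega> \<in> space M" for x s \<omega>
    unfolding abs_mult using A[of x] B[OF that, of s] A_nonneg abs_le_square_iff[of "H s \<omega>" B]
    by (intro mult_mono) auto
  have g_bound: "\<bar>g s\<bar> \<le> A * B\<^sup>2" for s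
  proof -
    have "norm (g s) \<le> expectation (\<lambda>\<omega>. norm (f2 (J (max 0 (min T s)) \<omega>) * (H s \<omega>)\<^sup>2))"
      unfolding g_def by (rule integral_norm_bound)
    also have "\<dots> \<le> A * B\<^sup>2"
    proof (rule integral_le_const)
      show "integrable M (\<lambda>\<omega>. norm (f2 (J (max 0 (min T s)) \<omega>) * (H s \<omega>)\<^sup>2))"
        by (rule integrable_const_bound[where B = "A * B\<^sup>2"]) (use bound2 in auto)
    qed (use bound2 in auto)
    finally show ?thesis by simp
  qed
  have g_int: "set_integrable lborel {a<..b} g" if "a \<le> b" for a b :: real
    unfolding set_integrable_def
    by (rule integrableI_bounded_set_indicator[where B = "A * B\<^sup>2"]) (use g_bound that in auto)

  \<comment> \<open>The claim is \<open>G t \<le> 0\<close>, and \<open>G 0 = 0\<close> since the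
    integral starts at \<open>0\<close>.\<close>
  define G where "G s = expectation (\<lambda>\<omega>. f (J s \<omega>)) - 1 / 2 * (LINT r:{0<..s}|lborel. g r)" for s
  define C where "C = L * B ^ 3"
  have "G t \<le> G 0"
  proof (rule piecewise_nonincreasing[OF P(1) t(1)])
    fix s r assume st: "0 \<le> s" "s < r" "r \<le> t" "P \<inter> {s<..<r} = {}"
    then have sT: "s \<le> T" and rT: "r \<le> T" using t by auto
    define h where "h = H r"
    note piece = P(2)[unfolded integral_off_def, rule_format, OF st(1,2) rT st(4), folded h_def]
    note hF = piece[THEN conjunct1]
    have h_const: "H q \<omega> = h \<omega>" and J_step: "J q \<omega> = J s \<omega> + h \<omega> * (W q \<omega> - W s \<omega>)"
      if "\<omega> \<in> space M" "s < q" "q \<le> r" for \<omega> q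
    proof -
      have "q \<in> {s<..r}" using that by simp
      with piece[THEN conjunct2] that(1)
      show "H q \<omega> = h \<omega>" "J q \<omega> = J s \<omega> + h \<omega> * (W q \<omega> - W s \<omega>)" by blast+
    qed
    have hB: "\<bar>h \<omega>\<bar> \<le> B" if "\<omega> \<in> space M" for \<omega> using B[OF that] by (simp add: h_def)
    have h3: "\<bar>h \<omega>\<bar> ^ 3 \<le> B ^ 3" if "\<omega> \<in> space M" for \<omega> using hB[OF that] by (intro power_mono) auto
    have h2: "(h \<omega>)\<^sup>2 \<le> B\<^sup>2" if "\<omega> \<in> space M" for \<omega>
      using hB[OF that] abs_le_square_iff[of "h \<omega>" B] B_nonneg by simp
    have [measurable]: "h \<in> borel_measurable M" by (rule filtration_measurable[OF hF]) (use st sT in auto)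
    note JsF = JF[OF st(1) sT]
    note [measurable] = JM[OF st(1) sT]
    have WM [measurable]: "W q \<in> borel_measurable M" if "0 \<le> q" "q \<le> T" for q using that by (rule brownian_measurable)
    note [measurable] = WM[OF st(1) sT] WM[of r]
    define e where "e = expectation (\<lambda>\<omega>. f2 (J s \<omega>) * (h \<omega>)\<^sup>2)"
    have z1F: "(\<lambda>\<omega>. f1 (J s \<omega>) * h \<omega>) \<in> borel_measurable (F s)"
      using JsF hF by (intro borel_measurable_times measurable_compose[OF JsF f_meas(2)])
    have z2F: "(\<lambda>\<omega>. f2 (J s \<omega>) * (h \<omega>)\<^sup>2) \<in> borel_measurable (F s)"
      using JsF hF by (intro borel_measurable_times borel_measurable_power measurable_compose[OF JsF f_meas(3)])
    have z1i: "integrable M (\<lambda>\<omega>. f1 (J s \<omega>) * h \<omega>)"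
    proof (rule Bochner_Integration.integrable_bound)
      show "integrable M (\<lambda>\<omega>. A * B * (1 + (J s \<omega>)\<^sup>2))"
        using Jsq[OF st(1) sT] by (intro integrable_mult_right Bochner_Integration.integrable_add) auto
      have "norm (f1 x * h \<omega>) \<le> norm (A * B * (1 + x\<^sup>2))" if "\<omega> \<in> space M" for \<omega> x
      proof -
        have "2 * \<bar>x\<bar> \<le> 1 + x\<^sup>2" using zero_le_power2[of "\<bar>x\<bar> - 1"] by (simp add: power2_eq_square algebra_simps)
        then have "\<bar>x\<bar> \<le> 1 + x\<^sup>2" by linarith
        then have "A * \<bar>x\<bar> \<le> A * (1 + x\<^sup>2)" using A_nonneg by (intro mult_left_mono)
        then have "\<bar>f1 x\<bar> * \<bar>h \<omega>\<bar> \<le> A * (1 + x\<^sup>2) * B"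
          using f1_bound[of x] hB[OF that] A_nonneg by (intro mult_mono) auto
        then show ?thesis using A_nonneg B_nonneg by (simp add: abs_mult mult_ac)
      qed
      then show "AE \<omega> in M. norm (f1 (J s \<omega>) * h \<omega>) \<le> norm (A * B * (1 + (J s \<omega>)\<^sup>2))" by simp
    qed measurable
    have z2i: "integrable M (\<lambda>\<omega>. f2 (J s \<omega>) * (h \<omega>)\<^sup>2)"
      by (rule integrable_const_bound[where B = "A * B\<^sup>2"]) (use bound2 in \<open>auto simp: h_def\<close>)
    note mom = increment_moments[OF st(1) st(2) rT]
    have m2: "integrable M (\<lambda>\<omega>. (W r \<omega> - W s \<omega>)\<^sup>2)" and m3: "integrable M (\<lambda>\<omega>. \<bar>W r \<omega> - W s \<omega>\<bar> ^ 3)"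
      and m1: "integrable M (\<lambda>\<omega>. W r \<omega> - W s \<omega>)"
      using mom(1)[of 2] mom(2)[of 3] mom(1)[of 1] by auto
    \<comment> \<open>The first-order term has expectation \<open>0\<close>; the second-order term
      contributes \<open>e * (r - s)\<close>.\<close>
    note p1 = increment_product[OF st(1) st(2) rT z1F z1i, of "\<lambda>x. x", OF _ m1, simplified mom(3)]
    note p2 = increment_product[OF st(1) st(2) rT z2F z2i, of "\<lambda>x. x\<^sup>2", OF _ m2, simplified mom(4)]
    have step: "expectation (\<lambda>\<omega>. f (J r \<omega>)) \<le>
        expectation (\<lambda>\<omega>. f (J s \<omega>)) + 1 / 2 * (e * (r - s)) + L / 6 * B ^ 3 * (2 * (r - s) * sqrt (r - s))"
    proof -
      have "expectation (\<lambda>\<omega>. f (J r \<omega>)) \<le> expectation (\<lambda>\<omega>. f (J s \<omega>) + f1 (J s \<omega>) * h \<omega> * (W r \<omega> - W s \<omega>) +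
          1 / 2 * (f2 (J s \<omega>) * (h \<omega>)\<^sup>2 * (W r \<omega> - W s \<omega>)\<^sup>2) + L / 6 * B ^ 3 * \<bar>W r \<omega> - W s \<omega>\<bar> ^ 3)"
      proof (rule integral_mono)
        show "integrable M (\<lambda>\<omega>. f (J r \<omega>))" using int_f st rT by auto
        show "integrable M (\<lambda>\<omega>. f (J s \<omega>) + f1 (J s \<omega>) * h \<omega> * (W r \<omega> - W s \<omega>) +
          1 / 2 * (f2 (J s \<omega>) * (h \<omega>)\<^sup>2 * (W r \<omega> - W s \<omega>)\<^sup>2) + L / 6 * B ^ 3 * \<bar>W r \<omega> - W s \<omega>\<bar> ^ 3)"
          using int_f[OF st(1) sT] p1(1) p2(1) m3
          by (intro Bochner_Integration.integrable_add integrable_mult_right) auto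
        fix \<omega> assume w: "\<omega> \<in> space M"
        define x where "x = W r \<omega> - W s \<omega>"
        have "f (J r \<omega>) \<le> f (J s \<omega>) + f1 (J s \<omega>) * (h \<omega> * x) + f2 (J s \<omega>) / 2 * (h \<omega> * x)\<^sup>2 + L / 6 * \<bar>h \<omega> * x\<bar> ^ 3"
          using abs_le_D1[OF taylor_third_order[OF f L, of "J s \<omega>" "h \<omega> * x"]] J_step[OF w st(2) order.refl]
          unfolding x_def by simp
        also have "L / 6 * \<bar>h \<omega> * x\<bar> ^ 3 \<le> L / 6 * B ^ 3 * \<bar>x\<bar> ^ 3"
          using h3[OF w] L_nonneg unfolding abs_mult power_mult_distrib mult.assoc
          by (intro mult_left_mono mult_right_mono) auto
        finally show "f (J r \<omega>) \<le> f (J s \<omega>) + f1 (J s \<omega>) * h \<omega> * (W r \<omega> - W s \<omega>) +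
          1 / 2 * (f2 (J s \<omega>) * (h \<omega>)\<^sup>2 * (W r \<omega> - W s \<omega>)\<^sup>2) + L / 6 * B ^ 3 * \<bar>W r \<omega> - W s \<omega>\<bar> ^ 3"
          by (simp add: x_def power_mult_distrib mult_ac)
      qed
      also have "\<dots> = expectation (\<lambda>\<omega>. f (J s \<omega>)) + 1 / 2 * (e * (r - s)) +
          L / 6 * B ^ 3 * expectation (\<lambda>\<omega>. \<bar>W r \<omega> - W s \<omega>\<bar> ^ 3)"
        using int_f[OF st(1) sT] p1 p2 m3 by (simp add: e_def)
      also have "\<dots> \<le> expectation (\<lambda>\<omega>. f (J s \<omega>)) + 1 / 2 * (e * (r - s)) + L / 6 * B ^ 3 * (2 * (r - s) * sqrt (r - s))"
        using mom(6) L_nonneg B_nonneg by (intro add_left_mono mult_left_mono) auto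
      finally show ?thesis .
    qed
    \<comment> \<open>Freezing \<open>J\<close> at time \<open>s\<close> inside \<open>f2\<close>
      costs at most \<open>L * \<bar>h\<bar> ^ 3\<close> times the absolute Brownian increment,
      whose expectation is of order \<open>sqrt (r - s)\<close>. Only the lower bound on
      \<open>g\<close> is relevant for an upper bound on \<open>G\<close>.\<close>
    have g_lower: "e - L * B ^ 3 * sqrt (r - s) \<le> g q" if q: "s < q" "q \<le> r" for q
    proof -
      have qT: "0 \<le> q" "q \<le> T" using q st rT by auto
      note mq = increment_moments[OF st(1) q(1) qT(2)]
      have i1: "integrable M (\<lambda>\<omega>. \<bar>W q \<omega> - W s \<omega>\<bar>)" using mq(2)[of 1] by simp
      have "e - L * B ^ 3 * sqrt (q - s) \<le> e - L * B ^ 3 * expectation (\<lambda>\<omega>. \<bar>W q \<omega> - W s \<omega>\<bar>)"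
        using mq(5) L_nonneg B_nonneg by (intro diff_left_mono mult_left_mono) auto
      also have "\<dots> = expectation (\<lambda>\<omega>. f2 (J s \<omega>) * (h \<omega>)\<^sup>2 - L * B ^ 3 * \<bar>W q \<omega> - W s \<omega>\<bar>)"
        using z2i i1 by (simp add: e_def)
      also have "\<dots> \<le> expectation (\<lambda>\<omega>. f2 (J (max 0 (min T q)) \<omega>) * (H q \<omega>)\<^sup>2)"
      proof (rule integral_mono)
        show "integrable M (\<lambda>\<omega>. f2 (J s \<omega>) * (h \<omega>)\<^sup>2 - L * B ^ 3 * \<bar>W q \<omega> - W s \<omega>\<bar>)"
          using z2i i1 by simp
        show "integrable M (\<lambda>\<omega>. f2 (J (max 0 (min T q)) \<omega>) * (H q \<omega>)\<^sup>2)"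
          by (rule integrable_const_bound[where B = "A * B\<^sup>2"]) (use bound2 in auto)
        fix \<omega> assume w: "\<omega> \<in> space M"
        define x where "x = W q \<omega> - W s \<omega>"
        have "f2 (J s \<omega>) - f2 (J q \<omega>) \<le> L * (\<bar>h \<omega>\<bar> * \<bar>x\<bar>)"
          using f2_lip[of "J q \<omega>" "J s \<omega>"] J_step[OF w q] by (simp add: x_def abs_mult)
        then have "(f2 (J s \<omega>) - f2 (J q \<omega>)) * (h \<omega>)\<^sup>2 \<le> L * (\<bar>h \<omega>\<bar> * \<bar>x\<bar>) * (h \<omega>)\<^sup>2"
          by (intro mult_right_mono) auto
        also have "\<dots> = L * (\<bar>h \<omega>\<bar> ^ 3 * \<bar>x\<bar>)"
          by (simp add: power3_eq_cube power2_eq_square mult_ac abs_mult_self_eq)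
        also have "\<dots> \<le> L * (B ^ 3 * \<bar>x\<bar>)"
          using h3[OF w] L_nonneg by (intro mult_left_mono mult_right_mono) auto
        finally show "f2 (J s \<omega>) * (h \<omega>)\<^sup>2 - L * B ^ 3 * \<bar>W q \<omega> - W s \<omega>\<bar> \<le> f2 (J (max 0 (min T q)) \<omega>) * (H q \<omega>)\<^sup>2"
          using qT h_const[OF w q] by (simp add: x_def algebra_simps)
      qed
      also have "\<dots> = g q" by (simp add: g_def)
      finally have "e - L * B ^ 3 * sqrt (q - s) \<le> g q" .
      moreover have "L * B ^ 3 * sqrt (q - s) \<le> L * B ^ 3 * sqrt (r - s)"
        using q L_nonneg B_nonneg by (intro mult_left_mono) auto
      ultimately show ?thesis by simp
    qed
    have "(r - s) * (e - L * B ^ 3 * sqrt (r - s)) = (LINT q:{s<..r}|lborel. e - L * B ^ 3 * sqrt (r - s))"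
      using st by (simp add: set_lebesgue_integral_def)
    also have "\<dots> \<le> (LINT q:{s<..r}|lborel. g q)"
      by (rule set_integral_mono[OF _ g_int[of s r]])
        (use g_lower st in \<open>auto simp: set_integrable_def\<close>)
    finally have low: "(r - s) * (e - L * B ^ 3 * sqrt (r - s)) \<le> (LINT q:{s<..r}|lborel. g q)" .
    have s_le_r: "s \<le> r" using st by simp
    have "{0<..r} = {0<..s} \<union> {s<..r}" using st by auto
    then have split: "(LINT q:{0<..r}|lborel. g q) = (LINT q:{0<..s}|lborel. g q) + (LINT q:{s<..r}|lborel. g q)"
      using set_integral_Un[OF _ g_int[OF st(1)] g_int[OF s_le_r]] by auto
    define k where "k = C * (r - s) * sqrt (r - s)"
    have eqs: "L / 6 * B ^ 3 * (2 * (r - s) * sqrt (r - s)) = 1 / 3 * k"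
      "(r - s) * (e - L * B ^ 3 * sqrt (r - s)) = e * (r - s) - k"
      by (simp_all add: k_def C_def algebra_simps)
    \<comment> \<open>The Taylor remainder accounts for \<open>1/3\<close> of \<open>k\<close>, and
      half of the variation of \<open>g\<close> for \<open>1/2\<close>.\<close>
    have "G r - G s \<le> 5 / 6 * k"
      using step low unfolding G_def split eqs by argo
    also have "\<dots> \<le> C * (r - s) * sqrt (r - s)"
      using st L_nonneg B_nonneg by (simp add: C_def k_def)
    finally show "G r - G s \<le> C * (r - s) * sqrt (r - s)" .
  qed
  moreover have "G 0 = 0"
  proof -
    have "expectation (\<lambda>\<omega>. f (J 0 \<omega>)) = expectation (\<lambda>\<omega>. 0)"
      using el f0 by (intro Bochner_Integration.integral_cong) (auto simp: elementary_def)
    then show ?thesis by (simp add: G_def set_lebesgue_integral_def)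
  qed
  moreover have "(LINT s:{0<..t}|lborel. g s) =
      (LINT s:{0<..t}|lborel. expectation (\<lambda>\<omega>. f2 (J s \<omega>) * (H s \<omega>)\<^sup>2))"
    by (rule set_lebesgue_integral_cong) (use t in \<open>auto simp: g_def\<close>)
  ultimately show "expectation (\<lambda>\<omega>. f (J t \<omega>)) \<le>
      1 / 2 * (LINT s:{0<..t}|lborel. expectation (\<lambda>\<omega>. f2 (J s \<omega>) * (H s \<omega>)\<^sup>2))"
    by (simp add: G_def)
qed

end

text \<open>If \<open>f\<close> is not integrable, its Bochner integral is \<open>0\<close> by
  convention; hence an inequality rather than an equation.\<close>

lemma ennreal_integral_le_nn_integral:
  assumes [measurable]: "f \<in> borel_measurable M" and "\<And>x. 0 \<le> f x"
  shows "ennreal (integral\<^sup>L M f) \<le> (\<integral>\<^sup>+x. ennreal (f x) \<partial>M)"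
  using assms by (subst integral_eq_nn_integral) (auto simp: ennreal_enn2real_if)

context brownian_motion
begin

text \<open>Markov's inequality for \<open>yw d\<close> is combined with Ito's inequality and
  Fubini. In \<open>bound\<close> the time integral is the inner one, so that the weighted energy
  can be estimated path by path.\<close>

lemma elementary_deviation:
  assumes el: "elementary H J" and d: "d > 0" and y: "y \<ge> 0" and t: "0 \<le> t" "t \<le> T" and c: "c \<ge> 0"
    and bound: "(\<integral>\<^sup>+\<omega>. (\<integral>\<^sup>+s\<in>{0<..T}. ennreal (1 / sqrt ((J s \<omega>)\<^sup>2 + d\<^sup>2) * (H s \<omega>)\<^sup>2) \<partial>lborel) \<partial>M) \<le> ennreal c"
  shows "yw d y * prob {\<omega>\<in>space M. y \<le> \<bar>J t \<omega>\<bar>} \<le> c / 2"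
proof -
  have T: "0 \<le> T" using t by simp
  have JM [measurable]: "J t \<in> borel_measurable M"
    using el t by (intro filtration_measurable[of _ t]) (auto simp: elementary_def)
  have HM [measurable]: "(\<lambda>(t, \<omega>). H t \<omega>) \<in> borel_measurable (lborel \<Otimes>\<^sub>M M)"
    using el by (simp add: elementary_def)
  note [measurable] = elementary_clamp_measurable[OF T el]
  define k where "k s \<omega> = 1 / sqrt ((J (max 0 (min T s)) \<omega>)\<^sup>2 + d\<^sup>2) * (H s \<omega>)\<^sup>2" for s \<omega>
  have k_meas [measurable]: "(\<lambda>(s, \<omega>). k s \<omega>) \<in> borel_measurable (lborel \<Otimes>\<^sub>M M)"
    unfolding k_def by measurable
  have k_nonneg: "0 \<le> k s \<omega>" for s \<omega> unfolding k_def by (intro mult_nonneg_nonneg) auto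
  define f1 f2 f3 where "f1 = (\<lambda>x. arsinh (x / d))" and "f2 = (\<lambda>x. 1 / sqrt (x\<^sup>2 + d\<^sup>2))"
    and "f3 = (\<lambda>x. - x / (sqrt (x\<^sup>2 + d\<^sup>2)) ^ 3)"
  have der: "\<And>x. (yw d has_real_derivative f1 x) (at x)" "\<And>x. (f1 has_real_derivative f2 x) (at x)"
    "\<And>x. (f2 has_real_derivative f3 x) (at x)"
    using yw_deriv1[OF d] yw_deriv2[OF d] yw_deriv3[OF d] by (simp_all add: f1_def f2_def f3_def)
  have bnd: "\<And>x. \<bar>f2 x\<bar> \<le> 1 / d" "\<And>x. \<bar>f3 x\<bar> \<le> 1 / d\<^sup>2"
    using yw_bound2[OF d] yw_bound3[OF d] unfolding f2_def f3_def by (simp_all add: abs_of_nonneg)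
  have zero: "yw d 0 = 0" "f1 0 = 0" using yw_0[OF d] by (simp_all add: f1_def)
  note ito = elementary_ito[OF el der bnd zero t]
  define g where "g s = expectation (k s)" for s
  have [measurable]: "g \<in> borel_measurable lborel" unfolding g_def by measurable
  have g_nonneg: "0 \<le> g s" for s unfolding g_def using k_nonneg by simp
  have "yw d y * prob {\<omega>\<in>space M. y \<le> \<bar>J t \<omega>\<bar>} = expectation (\<lambda>\<omega>. yw d y * indicator {\<omega>\<in>space M. y \<le> \<bar>J t \<omega>\<bar>} \<omega>)"
    by simp
  also have "\<dots> \<le> expectation (\<lambda>\<omega>. yw d (J t \<omega>))"
  proof (rule integral_mono[OF _ ito(1)])
    have ev: "{\<omega>\<in>space M. y \<le> \<bar>J t \<omega>\<bar>} \<in> events" by measurable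
    show "integrable M (\<lambda>\<omega>. yw d y * indicator {\<omega>\<in>space M. y \<le> \<bar>J t \<omega>\<bar>} \<omega>)"
      by (intro integrable_mult_right integrable_real_indicator ev) (simp add: less_top[symmetric])
  qed (use yw_nonneg[OF d] yw_mono[OF d y] in \<open>auto simp: indicator_def\<close>)
  also have "\<dots> \<le> 1 / 2 * (LINT s:{0<..t}|lborel. expectation (\<lambda>\<omega>. f2 (J s \<omega>) * (H s \<omega>)\<^sup>2))"
    by (rule ito(2))
  also have "(LINT s:{0<..t}|lborel. expectation (\<lambda>\<omega>. f2 (J s \<omega>) * (H s \<omega>)\<^sup>2)) = (LINT s:{0<..t}|lborel. g s)"
    by (rule set_lebesgue_integral_cong) (use t in \<open>auto simp: g_def k_def[abs_def] f2_def\<close>)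
  also have "1 / 2 * \<dots> \<le> 1 / 2 * c"
  proof -
    have "ennreal (LINT s:{0<..t}|lborel. g s) \<le> (\<integral>\<^sup>+s. ennreal (indicator {0<..t} s * g s) \<partial>lborel)"
      unfolding set_lebesgue_integral_def real_scaleR_def
      by (rule ennreal_integral_le_nn_integral) (use g_nonneg in auto)
    also have "\<dots> \<le> (\<integral>\<^sup>+s. \<integral>\<^sup>+\<omega>. ennreal (k s \<omega>) * indicator {0<..T} s \<partial>M \<partial>lborel)"
    proof (rule nn_integral_mono)
      fix s :: real
      have "ennreal (g s) \<le> (\<integral>\<^sup>+\<omega>. ennreal (k s \<omega>) \<partial>M)"
        unfolding g_def by (rule ennreal_integral_le_nn_integral) (use k_nonneg in auto)
      then show "ennreal (indicator {0<..t} s * g s) \<le> (\<integral>\<^sup>+\<omega>. ennreal (k s \<omega>) * indicator {0<..T} s \<partial>M)"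
        using t by (auto simp: indicator_def)
    qed
    also have "\<dots> = (\<integral>\<^sup>+\<omega>. \<integral>\<^sup>+s. ennreal (k s \<omega>) * indicator {0<..T} s \<partial>lborel \<partial>M)"
    proof (rule pair_sigma_finite.Fubini'[symmetric])
      show "pair_sigma_finite lborel M"
        by (intro pair_sigma_finite.intro lborel.sigma_finite_measure_axioms sigma_finite_measure_axioms)
    qed measurable
    also have "\<dots> = (\<integral>\<^sup>+\<omega>. (\<integral>\<^sup>+s\<in>{0<..T}. ennreal (1 / sqrt ((J s \<omega>)\<^sup>2 + d\<^sup>2) * (H s \<omega>)\<^sup>2) \<partial>lborel) \<partial>M)"
      by (intro nn_integral_cong) (auto simp: k_def indicator_def)
    also note bound
    finally show ?thesis using c by simp
  qed
  finally show ?thesis by simp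
qed

end

subsection \<open>Pathwise uniqueness\<close>

text \<open>The energy sum includes the step \<open>i\<close> itself. As the times are
  deterministic, this energy is already known at time \<open>\<tau> i\<close>, so the integrand can
  be switched off before the threshold is passed without looking ahead.\<close>

definition stopped :: "(nat \<Rightarrow> real) \<Rightarrow> real \<Rightarrow> (nat \<Rightarrow> 'a \<Rightarrow> real) \<Rightarrow> nat \<Rightarrow> 'a \<Rightarrow> real" where
  "stopped \<tau> R \<xi> i \<omega> = (if (\<Sum>j\<le>i. (\<xi> j \<omega>)\<^sup>2 * (\<tau> (Suc j) - \<tau> j)) \<le> R then \<xi> i \<omega> else 0)"

text \<open>If the original energy is within \<open>R\<close> up to the last step, it dominates the
  stopped energy. Otherwise the last step contributes nothing and the induction hypothesis
  applies.\<close>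

lemma stopped_energy_le:
  assumes "R \<ge> 0" "\<And>i. i < n \<Longrightarrow> \<tau> i \<le> \<tau> (Suc i)"
  shows "(\<Sum>i<n. (stopped \<tau> R \<xi> i \<omega>)\<^sup>2 * (\<tau> (Suc i) - \<tau> i)) \<le> R"
  using assms(2)
proof (induction n)
  case (Suc n)
  show ?case
  proof (cases "(\<Sum>j\<le>n. (\<xi> j \<omega>)\<^sup>2 * (\<tau> (Suc j) - \<tau> j)) \<le> R")
    case True
    have "(\<Sum>i<Suc n. (stopped \<tau> R \<xi> i \<omega>)\<^sup>2 * (\<tau> (Suc i) - \<tau> i)) \<le> (\<Sum>i<Suc n. (\<xi> i \<omega>)\<^sup>2 * (\<tau> (Suc i) - \<tau> i))"
      using Suc.prems by (intro sum_mono mult_right_mono) (auto simp: stopped_def)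
    also have "\<dots> \<le> R" using True by (simp add: lessThan_Suc_atMost)
    finally show ?thesis .
  qed (use Suc in \<open>simp add: stopped_def\<close>)
qed (use assms(1) in simp)

lemma stopped_eq:
  assumes "(\<Sum>i<n. (\<xi> i \<omega>)\<^sup>2 * (\<tau> (Suc i) - \<tau> i)) \<le> R" "\<And>i. i < n \<Longrightarrow> \<tau> i \<le> \<tau> (Suc i)" "i < n"
  shows "stopped \<tau> R \<xi> i \<omega> = \<xi> i \<omega>"
proof -
  have "(\<Sum>j\<le>i. (\<xi> j \<omega>)\<^sup>2 * (\<tau> (Suc j) - \<tau> j)) \<le> (\<Sum>i<n. (\<xi> i \<omega>)\<^sup>2 * (\<tau> (Suc i) - \<tau> i))"
    using assms by (intro sum_mono2) auto
  with assms(1) show ?thesis by (simp add: stopped_def)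
qed

lemma nondecreasing_upto:
  fixes \<tau> :: "nat \<Rightarrow> real"
  assumes "\<And>i. i < n \<Longrightarrow> \<tau> i \<le> \<tau> (Suc i)" "i \<le> j" "j \<le> n"
  shows "\<tau> i \<le> \<tau> j"
  using assms(2,3)
proof (induction rule: dec_induct)
  case (step k)
  then show ?case using assms(1)[of k] by simp
qed simp

text \<open>The step intervals are disjoint, so all mixed products vanish.\<close>

lemma simple_process_square:
  assumes "\<And>i. i < n \<Longrightarrow> \<tau> i \<le> \<tau> (Suc i)"
  shows "(simple_process n \<tau> \<xi> s \<omega>)\<^sup>2 = (\<Sum>i<n. (\<xi> i \<omega>)\<^sup>2 * indicator {\<tau> i<..\<tau> (Suc i)} s)"
  unfolding simple_process_def using assms
proof (induction n)
  case (Suc n)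
  let ?a = "\<Sum>i<n. \<xi> i \<omega> * indicator {\<tau> i<..\<tau> (Suc i)} s"
  let ?b = "\<xi> n \<omega> * indicator {\<tau> n<..\<tau> (Suc n)} s"
  have mono: "\<tau> i \<le> \<tau> n" if "i \<le> n" for i
    using nondecreasing_upto[of "Suc n" \<tau> i n] Suc.prems that by auto
  have "?a = 0" if "\<tau> n < s"
  proof (intro sum.neutral ballI)
    fix i assume "i \<in> {..<n}"
    then have "\<tau> (Suc i) \<le> \<tau> n" by (intro mono) auto
    with that show "\<xi> i \<omega> * indicator {\<tau> i<..\<tau> (Suc i)} s = 0" by (auto simp: indicator_def)
  qed
  then have "?a = 0 \<or> ?b = 0" by (auto simp: indicator_def)
  then have "(?a + ?b)\<^sup>2 = ?a\<^sup>2 + ?b\<^sup>2" by auto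
  also have "?b\<^sup>2 = (\<xi> n \<omega>)\<^sup>2 * indicator {\<tau> n<..\<tau> (Suc n)} s" by (simp add: indicator_def)
  finally show ?case using Suc by simp
qed simp

lemma simple_process_energy:
  assumes "\<And>i. i < n \<Longrightarrow> 0 \<le> \<tau> i \<and> \<tau> i \<le> \<tau> (Suc i) \<and> \<tau> (Suc i) \<le> T"
  shows "(\<integral>\<^sup>+s\<in>{0..T}. ennreal ((simple_process n \<tau> \<xi> s \<omega>)\<^sup>2) \<partial>lborel) =
    ennreal (\<Sum>i<n. (\<xi> i \<omega>)\<^sup>2 * (\<tau> (Suc i) - \<tau> i))"
proof -
  have "(\<integral>\<^sup>+s\<in>{0..T}. ennreal ((simple_process n \<tau> \<xi> s \<omega>)\<^sup>2) \<partial>lborel) =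
      (\<integral>\<^sup>+s. (\<Sum>i<n. ennreal ((\<xi> i \<omega>)\<^sup>2) * indicator {\<tau> i<..\<tau> (Suc i)} s) \<partial>lborel)"
  proof (rule nn_integral_cong)
    fix s :: real
    have "ennreal ((simple_process n \<tau> \<xi> s \<omega>)\<^sup>2) = (\<Sum>i<n. ennreal ((\<xi> i \<omega>)\<^sup>2) * indicator {\<tau> i<..\<tau> (Suc i)} s)"
    proof -
      have "(simple_process n \<tau> \<xi> s \<omega>)\<^sup>2 = (\<Sum>i<n. (\<xi> i \<omega>)\<^sup>2 * indicator {\<tau> i<..\<tau> (Suc i)} s)"
        using assms by (intro simple_process_square) auto
      also have "ennreal \<dots> = (\<Sum>i<n. ennreal ((\<xi> i \<omega>)\<^sup>2 * indicator {\<tau> i<..\<tau> (Suc i)} s))"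
        by (rule sum_ennreal[symmetric]) (simp add: indicator_def)
      also have "\<dots> = (\<Sum>i<n. ennreal ((\<xi> i \<omega>)\<^sup>2) * indicator {\<tau> i<..\<tau> (Suc i)} s)"
        by (intro sum.cong) (auto simp: indicator_def)
      finally show ?thesis .
    qed
    moreover have "(\<Sum>i<n. ennreal ((\<xi> i \<omega>)\<^sup>2) * indicator {\<tau> i<..\<tau> (Suc i)} s) = 0" if "s \<notin> {0..T}"
      using assms that by (intro sum.neutral ballI) (force simp: indicator_def)
    ultimately show "ennreal ((simple_process n \<tau> \<xi> s \<omega>)\<^sup>2) * indicator {0..T} s =
        (\<Sum>i<n. ennreal ((\<xi> i \<omega>)\<^sup>2) * indicator {\<tau> i<..\<tau> (Suc i)} s)"
      by (cases "s \<in> {0..T}") auto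
  qed
  also have "\<dots> = (\<Sum>i<n. ennreal ((\<xi> i \<omega>)\<^sup>2) * ennreal (\<tau> (Suc i) - \<tau> i))"
  proof (subst nn_integral_sum)
    show "(\<Sum>i<n. \<integral>\<^sup>+s. ennreal ((\<xi> i \<omega>)\<^sup>2) * indicator {\<tau> i<..\<tau> (Suc i)} s \<partial>lborel) =
        (\<Sum>i<n. ennreal ((\<xi> i \<omega>)\<^sup>2) * ennreal (\<tau> (Suc i) - \<tau> i))"
      using assms by (intro sum.cong refl, subst nn_integral_cmult_indicator) auto
  qed simp
  also have "\<dots> = ennreal (\<Sum>i<n. (\<xi> i \<omega>)\<^sup>2 * (\<tau> (Suc i) - \<tau> i))"
  proof (subst sum_ennreal[symmetric])
    show "(\<Sum>i<n. ennreal ((\<xi> i \<omega>)\<^sup>2) * ennreal (\<tau> (Suc i) - \<tau> i)) =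
        (\<Sum>i<n. ennreal ((\<xi> i \<omega>)\<^sup>2 * (\<tau> (Suc i) - \<tau> i)))"
      using assms by (intro sum.cong refl ennreal_mult[symmetric]) auto
  qed (use assms in auto)
  finally show ?thesis .
qed

lemma (in brownian_motion) stopped_simple_integrand:
  assumes "simple_integrand M F T n \<tau> \<xi>"
  shows "simple_integrand M F T n \<tau> (stopped \<tau> R \<xi>)"
  unfolding simple_integrand_def
proof (intro allI impI)
  fix i assume i: "i < n"
  have a: "0 \<le> \<tau> j" "\<tau> j \<le> \<tau> (Suc j)" "\<tau> (Suc j) \<le> T" "\<xi> j \<in> borel_measurable (F (\<tau> j))" if "j < n" for j
    using assms that by (auto simp: simple_integrand_def)
  obtain B where B: "\<forall>\<omega>\<in>space M. \<bar>\<xi> i \<omega>\<bar> \<le> B" using assms i unfolding simple_integrand_def by metis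
  have mono: "\<tau> j \<le> \<tau> i" if "j \<le> i" for j
    by (rule nondecreasing_upto[where n = n]) (use a(2) that i in simp_all)
  have m: "\<xi> j \<in> borel_measurable (F (\<tau> i))" if "j \<le> i" for j
  proof (rule filtration_measurable_mono[of "\<xi> j" "\<tau> j" "\<tau> i"])
    have "j < n" using that i by simp
    then show "\<xi> j \<in> borel_measurable (F (\<tau> j))" "0 \<le> \<tau> j" by (fact a)+
    show "\<tau> j \<le> \<tau> i" using that by (rule mono)
    show "\<tau> i \<le> T" using a(2,3)[OF i] by linarith
  qed
  have "(\<lambda>\<omega>. \<Sum>j\<le>i. (\<xi> j \<omega>)\<^sup>2 * (\<tau> (Suc j) - \<tau> j)) \<in> borel_measurable (F (\<tau> i))"
    using m by (intro borel_measurable_sum borel_measurable_times borel_measurable_power borel_measurable_const) auto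
  with m[of i] have "stopped \<tau> R \<xi> i \<in> borel_measurable (F (\<tau> i))"
    unfolding stopped_def[abs_def] by measurable
  moreover have "\<exists>B. \<forall>\<omega>\<in>space M. \<bar>stopped \<tau> R \<xi> i \<omega>\<bar> \<le> B"
    using B by (intro exI[of _ B]) (auto simp: stopped_def intro: order.trans[OF abs_ge_zero])
  ultimately show "0 \<le> \<tau> i \<and> \<tau> i \<le> \<tau> (Suc i) \<and> \<tau> (Suc i) \<le> T \<and>
      stopped \<tau> R \<xi> i \<in> borel_measurable (F (\<tau> i)) \<and> (\<exists>B. \<forall>\<omega>\<in>space M. \<bar>stopped \<tau> R \<xi> i \<omega>\<bar> \<le> B)"
    using a[OF i] by auto
qed

section \<open>Approximation of an Ito integral with controlled energy\<close>

text \<open>Rational times of the open interval are dense in the closed one, and a weak upper bound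
  extends by continuity. This gives measurability of events about suprema, and later carries almost
  sure equality from countably many times to all of them.\<close>

lemma less_SUP_iff_rational:
  fixes f :: "real \<Rightarrow> real"
  assumes "0 < T" "continuous_on {0..T} f"
  shows "e < (SUP t\<in>{0..T}. f t) \<longleftrightarrow> (\<exists>q\<in>\<rat> \<inter> {0<..<T}. e < f q)"
proof -
  have bdd: "bdd_above (f ` {0..T})"
    using compact_continuous_image[OF assms(2)] by (auto intro: bounded_imp_bdd_above compact_imp_bounded)
  have *: "e < (SUP t\<in>{0..T}. f t) \<longleftrightarrow> (\<exists>t\<in>{0..T}. e < f t)"
    using bdd assms(1) by (intro less_cSUP_iff) auto
  have "closure ({0<..<T} \<inter> \<rat>) = closure {0<..<T}"
    by (rule closure_open_Int_superset) (auto simp: Rats_closure_real)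
  then have cl: "closure (\<rat> \<inter> {0<..<T}) = {0..T}" using assms(1) by (simp add: Int_commute)
  have "f t \<le> e" if "\<forall>q\<in>\<rat> \<inter> {0<..<T}. f q \<le> e" "t \<in> {0..T}" for t
    by (rule continuous_le_on_closure[of "\<rat> \<inter> {0<..<T}"]) (use cl that assms(2) in auto)
  then have "(\<exists>t\<in>{0..T}. e < f t) \<longleftrightarrow> (\<exists>q\<in>\<rat> \<inter> {0<..<T}. e < f q)"
    by (force simp: not_le[symmetric])
  with * show ?thesis by simp
qed

context brownian_motion
begin

lemma progressive_clamp_measurable:
  assumes "progressive F T H" "0 \<le> T"
  shows "(\<lambda>(s, \<omega>). H (max 0 (min T s)) \<omega>) \<in> borel_measurable (lborel \<Otimes>\<^sub>M M)"
proof -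
  have T: "T \<in> {0..T}" using assms(2) by simp
  have H: "(\<lambda>(s, \<omega>). H s \<omega>) \<in> borel_measurable (restrict_space borel {0..T} \<Otimes>\<^sub>M F T)"
    using assms(1) T unfolding progressive_def by blast
  have id: "(\<lambda>x. x) \<in> M \<rightarrow>\<^sub>M F T"
    using subalgebra[OF T] by (auto simp: measurable_def subalgebra_def)
  have "(\<lambda>s. max 0 (min T s)) \<in> lborel \<rightarrow>\<^sub>M restrict_space borel {0..T}"
    by (rule measurable_restrict_space2) (use assms(2) in auto)
  then have "(\<lambda>x. (max 0 (min T (fst x)), snd x)) \<in> lborel \<Otimes>\<^sub>M M \<rightarrow>\<^sub>M restrict_space borel {0..T} \<Otimes>\<^sub>M F T"
    by (intro measurable_Pair measurable_compose[OF measurable_fst] measurable_compose[OF measurable_snd id])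
  from measurable_compose[OF this H] show ?thesis by (simp add: split_def)
qed

text \<open>The given simple integrands converge in probability only, so their energy is
  uncontrolled on a small event. Stopping bounds the energy on every path, including those in
  \<open>B\<close>, while the approximation is untouched outside \<open>B\<close> wherever the
  energy of \<open>H\<close> is at most \<open>R\<close>.\<close>

lemma ito_approximation:
  assumes ito: "has_ito_integral M F T W H I" and T: "0 < T" and R: "0 \<le> R"
    and e: "0 < e" "e \<le> 1" and p: "0 < p"
  shows "\<exists>H' J' B. elementary H' J' \<and>
    (\<forall>\<omega>. (\<integral>\<^sup>+s\<in>{0..T}. ennreal ((H' s \<omega>)\<^sup>2) \<partial>lborel) \<le> ennreal (2 * R + 2)) \<and>
    B \<in> events \<and> prob B < p \<and>
    (\<forall>\<omega>\<in>space M - B. (\<integral>\<^sup>+s\<in>{0..T}. ennreal ((H s \<omega>)\<^sup>2) \<partial>lborel) \<le> ennreal R \<longrightarrow>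
      (\<integral>\<^sup>+s\<in>{0..T}. ennreal ((H' s \<omega> - H s \<omega>)\<^sup>2) \<partial>lborel) \<le> ennreal e \<and>
      (\<forall>t\<in>{0..T}. \<bar>J' t \<omega> - I t \<omega>\<bar> \<le> e))"
proof -
  obtain n \<tau> \<xi> where simple: "\<And>k. simple_integrand M F T (n k) (\<tau> k) (\<xi> k)"
    and lim1: "(\<lambda>k. measure M {\<omega>\<in>space M. (\<integral>\<^sup>+s\<in>{0..T}.
          ennreal ((simple_process (n k) (\<tau> k) (\<xi> k) s \<omega> - H s \<omega>)\<^sup>2) \<partial>lborel) > ennreal e}) \<longlonglongrightarrow> 0"
    and lim2: "(\<lambda>k. measure M {\<omega>\<in>space M.
          (SUP t\<in>{0..T}. \<bar>simple_integral W (n k) (\<tau> k) (\<xi> k) t \<omega> - I t \<omega>\<bar>) > e}) \<longlonglongrightarrow> 0"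
    using ito e(1) unfolding has_ito_integral_def by blast
  have H: "progressive F T H" and I: "adapted F T I" "continuous_paths M T I"
    using ito by (auto simp: has_ito_integral_def)
  note Hm [measurable] = progressive_clamp_measurable[OF H order.strict_implies_order[OF T]]
  have "eventually (\<lambda>k. measure M {\<omega>\<in>space M. (\<integral>\<^sup>+s\<in>{0..T}.
          ennreal ((simple_process (n k) (\<tau> k) (\<xi> k) s \<omega> - H s \<omega>)\<^sup>2) \<partial>lborel) > ennreal e} < p / 2 \<and>
      measure M {\<omega>\<in>space M.
          (SUP t\<in>{0..T}. \<bar>simple_integral W (n k) (\<tau> k) (\<xi> k) t \<omega> - I t \<omega>\<bar>) > e} < p / 2) sequentially"
    using p by (intro eventually_conj order_tendstoD(2)[OF lim1] order_tendstoD(2)[OF lim2]) auto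
  then obtain k where k: "measure M {\<omega>\<in>space M. (\<integral>\<^sup>+s\<in>{0..T}.
          ennreal ((simple_process (n k) (\<tau> k) (\<xi> k) s \<omega> - H s \<omega>)\<^sup>2) \<partial>lborel) > ennreal e} < p / 2"
      "measure M {\<omega>\<in>space M.
          (SUP t\<in>{0..T}. \<bar>simple_integral W (n k) (\<tau> k) (\<xi> k) t \<omega> - I t \<omega>\<bar>) > e} < p / 2"
    unfolding eventually_sequentially by blast
  define N \<sigma> \<zeta> where "N = n k" and "\<sigma> = \<tau> k" and "\<zeta> = \<xi> k"
  define S where "S = simple_process N \<sigma> \<zeta>"
  define J where "J = simple_integral W N \<sigma> \<zeta>"
  define B1 where "B1 = {\<omega>\<in>space M. (\<integral>\<^sup>+s\<in>{0..T}. ennreal ((S s \<omega> - H s \<omega>)\<^sup>2) \<partial>lborel) > ennreal e}"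
  define B2 where "B2 = {\<omega>\<in>space M. (SUP t\<in>{0..T}. \<bar>J t \<omega> - I t \<omega>\<bar>) > e}"
  have pB: "prob B1 < p / 2" "prob B2 < p / 2"
    using k by (simp_all add: B1_def B2_def S_def J_def N_def \<sigma>_def \<zeta>_def)
  have simple': "simple_integrand M F T N \<sigma> \<zeta>" using simple by (simp add: N_def \<sigma>_def \<zeta>_def)
  then have times: "\<And>i. i < N \<Longrightarrow> 0 \<le> \<sigma> i \<and> \<sigma> i \<le> \<sigma> (Suc i) \<and> \<sigma> (Suc i) \<le> T"
    by (simp add: simple_integrand_def)
  have elSJ: "elementary S J" unfolding S_def J_def by (rule elementary_simple[OF simple'])
  have Sm [measurable]: "(\<lambda>(t, \<omega>). S t \<omega>) \<in> borel_measurable (lborel \<Otimes>\<^sub>M M)"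
    using elSJ by (simp add: elementary_def)
  \<comment> \<open>Progressive measurability concerns \<open>{0..T}\<close> only; clamping the time
    inside the integral does not change its value.\<close>
  have "(\<lambda>\<omega>. \<integral>\<^sup>+s\<in>{0..T}. ennreal ((S s \<omega> - H (max 0 (min T s)) \<omega>)\<^sup>2) \<partial>lborel) \<in> borel_measurable M"
    by measurable
  moreover have "(\<integral>\<^sup>+s\<in>{0..T}. ennreal ((S s \<omega> - H (max 0 (min T s)) \<omega>)\<^sup>2) \<partial>lborel) =
      (\<integral>\<^sup>+s\<in>{0..T}. ennreal ((S s \<omega> - H s \<omega>)\<^sup>2) \<partial>lborel)" for \<omega>
    by (intro nn_integral_cong) (auto simp: indicator_def)
  ultimately have [measurable]: "(\<lambda>\<omega>. \<integral>\<^sup>+s\<in>{0..T}. ennreal ((S s \<omega> - H s \<omega>)\<^sup>2) \<partial>lborel) \<in> borel_measurable M"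
    by simp
  have B1e: "B1 \<in> events" unfolding B1_def by measurable
  have contJI: "continuous_on {0..T} (\<lambda>t. \<bar>J t \<omega> - I t \<omega>\<bar>)" if "\<omega> \<in> space M" for \<omega>
    using elSJ I that by (auto simp: elementary_def continuous_paths_def intro!: continuous_intros)
  have B2e: "B2 \<in> events"
  proof -
    have "B2 = (\<Union>q\<in>\<rat> \<inter> {0<..<T}. {\<omega>\<in>space M. e < \<bar>J q \<omega> - I q \<omega>\<bar>})"
      unfolding B2_def using less_SUP_iff_rational[OF T contJI] by auto
    also have "\<dots> \<in> events"
    proof (rule sets.countable_UN')
      show "countable (\<rat> \<inter> {0<..<T})" by (simp add: countable_rat countable_Int1)
      show "(\<lambda>q. {\<omega>\<in>space M. e < \<bar>J q \<omega> - I q \<omega>\<bar>}) ` (\<rat> \<inter> {0<..<T}) \<subseteq> events"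
      proof safe
        fix q assume q: "q \<in> {0<..<T}"
        then have "J q \<in> borel_measurable (F q)" "I q \<in> borel_measurable (F q)" "q \<in> {0..T}"
          using elSJ I(1) by (auto simp: elementary_def adapted_def)
        then have [measurable]: "J q \<in> borel_measurable M" "I q \<in> borel_measurable M"
          by (blast intro: filtration_measurable)+
        show "{\<omega>\<in>space M. e < \<bar>J q \<omega> - I q \<omega>\<bar>} \<in> events" by measurable
      qed
    qed
    finally show ?thesis .
  qed
  \<comment> \<open>The threshold comes from
    \<open>a\<^sup>2 \<le> 2 * b\<^sup>2 + 2 * (a - b)\<^sup>2\<close>: on a good path the energy of
    \<open>S\<close> is at most \<open>2 * R + 2 * e\<close>, and \<open>e \<le> 1\<close>.\<close>
  define Z where "Z = stopped \<sigma> (2 * R + 2) \<zeta>"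
  define H' where "H' = simple_process N \<sigma> Z"
  define J' where "J' = simple_integral W N \<sigma> Z"
  have good: "(\<integral>\<^sup>+s\<in>{0..T}. ennreal ((H' s \<omega> - H s \<omega>)\<^sup>2) \<partial>lborel) \<le> ennreal e \<and>
      (\<forall>t\<in>{0..T}. \<bar>J' t \<omega> - I t \<omega>\<bar> \<le> e)"
    if w: "\<omega> \<in> space M - (B1 \<union> B2)" and HR: "(\<integral>\<^sup>+s\<in>{0..T}. ennreal ((H s \<omega>)\<^sup>2) \<partial>lborel) \<le> ennreal R" for \<omega>
  proof -
    have wM: "\<omega> \<in> space M" using w by simp
    have 1: "(\<integral>\<^sup>+s\<in>{0..T}. ennreal ((S s \<omega> - H s \<omega>)\<^sup>2) \<partial>lborel) \<le> ennreal e"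
      using w by (auto simp: B1_def not_less)
    have 2: "(SUP t\<in>{0..T}. \<bar>J t \<omega> - I t \<omega>\<bar>) \<le> e"
      using w by (auto simp: B2_def not_less)
    have bdd: "bdd_above ((\<lambda>t. \<bar>J t \<omega> - I t \<omega>\<bar>) ` {0..T})"
      using compact_continuous_image[OF contJI[OF wM]]
      by (auto intro: bounded_imp_bdd_above compact_imp_bounded)
    have "ennreal (\<Sum>i<N. (\<zeta> i \<omega>)\<^sup>2 * (\<sigma> (Suc i) - \<sigma> i)) = (\<integral>\<^sup>+s\<in>{0..T}. ennreal ((S s \<omega>)\<^sup>2) \<partial>lborel)"
      unfolding S_def by (rule simple_process_energy[symmetric]) (rule times)
    also have "\<dots> \<le> (\<integral>\<^sup>+s. 2 * (ennreal ((H (max 0 (min T s)) \<omega>)\<^sup>2) * indicator {0..T} s) +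
        2 * (ennreal ((S s \<omega> - H (max 0 (min T s)) \<omega>)\<^sup>2) * indicator {0..T} s) \<partial>lborel)"
    proof (rule nn_integral_mono)
      fix s
      \<comment> \<open>The right-hand side exceeds the left-hand side by
        \<open>(a - 2 * b)\<^sup>2\<close>.\<close>
      have "a\<^sup>2 \<le> 2 * b\<^sup>2 + 2 * (a - b)\<^sup>2" for a b :: real
        using zero_le_power2[of "a - 2 * b"] by (simp add: power2_eq_square algebra_simps)
      then have "ennreal ((S s \<omega>)\<^sup>2) \<le> ennreal (2 * (H (max 0 (min T s)) \<omega>)\<^sup>2 + 2 * (S s \<omega> - H (max 0 (min T s)) \<omega>)\<^sup>2)"
        by (rule ennreal_leI)
      also have "\<dots> = 2 * ennreal ((H (max 0 (min T s)) \<omega>)\<^sup>2) + 2 * ennreal ((S s \<omega> - H (max 0 (min T s)) \<omega>)\<^sup>2)"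
        by (simp add: ennreal_mult)
      finally show "ennreal ((S s \<omega>)\<^sup>2) * indicator {0..T} s \<le>
          2 * (ennreal ((H (max 0 (min T s)) \<omega>)\<^sup>2) * indicator {0..T} s) +
          2 * (ennreal ((S s \<omega> - H (max 0 (min T s)) \<omega>)\<^sup>2) * indicator {0..T} s)"
        by (cases "s \<in> {0..T}") auto
    qed
    also have "\<dots> = 2 * (\<integral>\<^sup>+s\<in>{0..T}. ennreal ((H (max 0 (min T s)) \<omega>)\<^sup>2) \<partial>lborel) +
        2 * (\<integral>\<^sup>+s\<in>{0..T}. ennreal ((S s \<omega> - H (max 0 (min T s)) \<omega>)\<^sup>2) \<partial>lborel)"
      using wM by (subst nn_integral_add) (auto simp: nn_integral_cmult)
    also have "(\<integral>\<^sup>+s\<in>{0..T}. ennreal ((H (max 0 (min T s)) \<omega>)\<^sup>2) \<partial>lborel) =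
        (\<integral>\<^sup>+s\<in>{0..T}. ennreal ((H s \<omega>)\<^sup>2) \<partial>lborel)"
      by (intro nn_integral_cong) (auto simp: indicator_def)
    also have "(\<integral>\<^sup>+s\<in>{0..T}. ennreal ((S s \<omega> - H (max 0 (min T s)) \<omega>)\<^sup>2) \<partial>lborel) =
        (\<integral>\<^sup>+s\<in>{0..T}. ennreal ((S s \<omega> - H s \<omega>)\<^sup>2) \<partial>lborel)"
      by (intro nn_integral_cong) (auto simp: indicator_def)
    also have "2 * (\<integral>\<^sup>+s\<in>{0..T}. ennreal ((H s \<omega>)\<^sup>2) \<partial>lborel) + 2 * (\<integral>\<^sup>+s\<in>{0..T}. ennreal ((S s \<omega> - H s \<omega>)\<^sup>2) \<partial>lborel)
        \<le> 2 * ennreal R + 2 * ennreal e"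
      by (intro add_mono mult_left_mono HR 1) auto
    also have "\<dots> = ennreal (2 * R + 2 * e)" using R e by (simp add: ennreal_mult)
    also have "\<dots> \<le> ennreal (2 * R + 2)" using e by (intro ennreal_leI) simp
    finally have "(\<Sum>i<N. (\<zeta> i \<omega>)\<^sup>2 * (\<sigma> (Suc i) - \<sigma> i)) \<le> 2 * R + 2"
      using R by (subst (asm) ennreal_le_iff) auto
    \<comment> \<open>Within the threshold nothing is switched off, so the stopped objects agree
      with \<open>S\<close> and \<open>J\<close> on this path.\<close>
    then have "Z i \<omega> = \<zeta> i \<omega>" if "i < N" for i
      unfolding Z_def using times that by (intro stopped_eq[where n = N]) auto
    then have eq: "H' s \<omega> = S s \<omega>" "J' s \<omega> = J s \<omega>" for s
      unfolding H'_def J'_def S_def J_def simple_process_def simple_integral_def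
      by (auto intro!: sum.cong)
    have "\<bar>J t \<omega> - I t \<omega>\<bar> \<le> e" if "t \<in> {0..T}" for t
      using cSUP_upper[OF that bdd] 2 by linarith
    with 1 show ?thesis unfolding eq by blast
  qed
  show ?thesis
  proof (intro exI conjI allI ballI impI)
    show "elementary H' J'"
      unfolding H'_def J'_def Z_def by (intro elementary_simple stopped_simple_integrand simple')
    show "(\<integral>\<^sup>+s\<in>{0..T}. ennreal ((H' s \<omega>)\<^sup>2) \<partial>lborel) \<le> ennreal (2 * R + 2)" for \<omega>
    proof -
      have "(\<integral>\<^sup>+s\<in>{0..T}. ennreal ((H' s \<omega>)\<^sup>2) \<partial>lborel) = ennreal (\<Sum>i<N. (Z i \<omega>)\<^sup>2 * (\<sigma> (Suc i) - \<sigma> i))"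
        unfolding H'_def by (rule simple_process_energy) (rule times)
      also have "\<dots> \<le> ennreal (2 * R + 2)"
        unfolding Z_def using times R by (intro ennreal_leI stopped_energy_le) auto
      finally show ?thesis .
    qed
    show "B1 \<union> B2 \<in> events" using B1e B2e by simp
    show "prob (B1 \<union> B2) < p" using measure_Un_le[OF B1e B2e] pB by linarith
  next
    fix \<omega> assume w: "\<omega> \<in> space M - (B1 \<union> B2)" and HR: "(\<integral>\<^sup>+s\<in>{0..T}. ennreal ((H s \<omega>)\<^sup>2) \<partial>lborel) \<le> ennreal R"
    show "(\<integral>\<^sup>+s\<in>{0..T}. ennreal ((H' s \<omega> - H s \<omega>)\<^sup>2) \<partial>lborel) \<le> ennreal e"
      using good[OF w HR] by (rule conjunct1)
    show "\<bar>J' t \<omega> - I t \<omega>\<bar> \<le> e" if "t \<in> {0..T}" for t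
      using good[OF w HR] that by blast
  qed
qed

end

section \<open>The Yamada--Watanabe estimate for two Ito integrals\<close>

text \<open>The pointwise bound is asked for at positive times only, since the laws of the solutions
  have the prescribed densities only there.\<close>

lemma nn_integral_combination_le:
  fixes f g h k :: "real \<Rightarrow> real"
  assumes [measurable]: "f \<in> borel_measurable lborel" "g \<in> borel_measurable lborel" "h \<in> borel_measurable lborel"
    and nonneg: "\<And>s. 0 \<le> f s" "\<And>s. 0 \<le> g s" "\<And>s. 0 \<le> h s" "0 \<le> a" "0 \<le> b" "0 \<le> F" "0 \<le> G"
    and le: "\<And>s. s \<in> {0<..T} \<Longrightarrow> k s \<le> a * f s + b * (g s + h s)"
    and f: "(\<integral>\<^sup>+s\<in>{0..T}. ennreal (f s) \<partial>lborel) \<le> ennreal F"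
    and g: "(\<integral>\<^sup>+s\<in>{0..T}. ennreal (g s) \<partial>lborel) \<le> ennreal G"
    and h: "(\<integral>\<^sup>+s\<in>{0..T}. ennreal (h s) \<partial>lborel) \<le> ennreal G"
  shows "(\<integral>\<^sup>+s\<in>{0<..T}. ennreal (k s) \<partial>lborel) \<le> ennreal (a * F + b * (2 * G))"
proof -
  have "(\<integral>\<^sup>+s\<in>{0<..T}. ennreal (k s) \<partial>lborel) \<le>
      (\<integral>\<^sup>+s. ennreal a * (ennreal (f s) * indicator {0..T} s) +
        (ennreal b * (ennreal (g s) * indicator {0..T} s) + ennreal b * (ennreal (h s) * indicator {0..T} s)) \<partial>lborel)"
  proof (rule nn_integral_mono)
    fix s
    show "ennreal (k s) * indicator {0<..T} s \<le> ennreal a * (ennreal (f s) * indicator {0..T} s) +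
        (ennreal b * (ennreal (g s) * indicator {0..T} s) + ennreal b * (ennreal (h s) * indicator {0..T} s))"
    proof (cases "s \<in> {0<..T}")
      case True
      have "ennreal (k s) \<le> ennreal (a * f s + b * (g s + h s))" by (rule ennreal_leI[OF le[OF True]])
      also have "\<dots> = ennreal a * ennreal (f s) + (ennreal b * ennreal (g s) + ennreal b * ennreal (h s))"
        using nonneg by (simp add: ennreal_mult distrib_left)
      finally show ?thesis using True by simp
    qed simp
  qed
  also have "\<dots> = ennreal a * (\<integral>\<^sup>+s\<in>{0..T}. ennreal (f s) \<partial>lborel) +
      (ennreal b * (\<integral>\<^sup>+s\<in>{0..T}. ennreal (g s) \<partial>lborel) + ennreal b * (\<integral>\<^sup>+s\<in>{0..T}. ennreal (h s) \<partial>lborel))"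
    by (simp add: nn_integral_add nn_integral_cmult)
  also have "\<dots> \<le> ennreal a * ennreal F + (ennreal b * ennreal G + ennreal b * ennreal G)"
    by (intro add_mono mult_left_mono f g h) auto
  also have "\<dots> = ennreal (a * F + b * (2 * G))"
    using nonneg by (simp add: ennreal_mult[symmetric] ennreal_plus[symmetric] del: ennreal_plus)
  finally show ?thesis .
qed

text \<open>Here \<open>D\<close> is the true difference of the integrals, \<open>j\<close> its
  approximation, \<open>a\<close> the true difference of the integrands, and \<open>x\<close>,
  \<open>y\<close> are approximation errors. As \<open>j\<close> is within \<open>d\<close> of
  \<open>D\<close>, the weighted size \<open>\<bar>D\<bar> * w\<close> is at most \<open>2\<close>,
  so the main term is free of \<open>d\<close>.\<close>

lemma weighted_square_le:
  fixes w d j D a x y k :: real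
  assumes w: "0 \<le> w" "w \<le> 1 / d" "\<bar>j\<bar> * w \<le> 1" and d: "0 < d" and jD: "\<bar>j - D\<bar> \<le> d"
    and k: "0 \<le> k" "a\<^sup>2 \<le> k * \<bar>D\<bar>"
  shows "w * (a + x - y)\<^sup>2 \<le> 4 * k + 4 / d * (x\<^sup>2 + y\<^sup>2)"
proof -
  have "(a + x - y)\<^sup>2 \<le> 2 * a\<^sup>2 + 4 * x\<^sup>2 + 4 * y\<^sup>2"
    \<comment> \<open>The slack is \<open>(a - x + y)\<^sup>2 + 2 * (x + y)\<^sup>2\<close>.\<close>
    using zero_le_power2[of "a - x + y"] zero_le_power2[of "x + y"] by (simp add: power2_eq_square algebra_simps)
  then have "w * (a + x - y)\<^sup>2 \<le> w * (2 * a\<^sup>2 + 4 * x\<^sup>2 + 4 * y\<^sup>2)"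
    using w(1) by (rule mult_left_mono)
  also have "\<dots> = 2 * (w * a\<^sup>2) + 4 * (w * (x\<^sup>2 + y\<^sup>2))" by (simp add: algebra_simps)
  also have "w * a\<^sup>2 \<le> k * 2"
  proof -
    have "w * a\<^sup>2 \<le> w * (k * \<bar>D\<bar>)" using k(2) w(1) by (rule mult_left_mono)
    also have "\<dots> = k * (\<bar>D\<bar> * w)" by simp
    also have "\<bar>D\<bar> * w \<le> (\<bar>j\<bar> + d) * w" using jD w(1) by (intro mult_right_mono) auto
    also have "\<dots> \<le> 2" using w d by (simp add: field_simps)
    finally show ?thesis using k(1) by (simp add: mult_left_mono)
  qed
  also have "w * (x\<^sup>2 + y\<^sup>2) \<le> 1 / d * (x\<^sup>2 + y\<^sup>2)" using w(2) by (intro mult_right_mono) auto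
  finally show ?thesis by simp
qed

context brownian_motion
begin

text \<open>The point is that the bound does not depend on \<open>d\<close>. Outside a small event
  the weighted energy of the approximations is at most \<open>4 * \<kappa> + 4\<close>. On that
  event it is bounded by a constant depending on \<open>R\<close> and \<open>d\<close>, and the
  event is chosen small after \<open>d\<close> is fixed.\<close>

lemma ito_difference_deviation:
  assumes T: "0 < T" and ito: "has_ito_integral M F T W H1 I1" "has_ito_integral M F T W H2 I2"
    and R: "0 \<le> R" "AE \<omega> in M. (\<integral>\<^sup>+s\<in>{0..T}. ennreal ((H1 s \<omega>)\<^sup>2) \<partial>lborel) \<le> ennreal R"
      "AE \<omega> in M. (\<integral>\<^sup>+s\<in>{0..T}. ennreal ((H2 s \<omega>)\<^sup>2) \<partial>lborel) \<le> ennreal R"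
    and K [measurable]: "K \<in> borel_measurable lborel"
    and K_nonneg: "\<And>s. 0 \<le> K s"
    and K_int: "0 \<le> \<kappa>" "(\<integral>\<^sup>+s\<in>{0..T}. ennreal (K s) \<partial>lborel) \<le> ennreal \<kappa>"
    and K_bound: "AE \<omega> in M. \<forall>s\<in>{0<..T}. (H1 s \<omega> - H2 s \<omega>)\<^sup>2 \<le> K s * \<bar>I1 s \<omega> - I2 s \<omega>\<bar>"
    and d: "0 < d" "d \<le> 1" and y: "0 < y" and t: "0 \<le> t" "t \<le> T"
  shows "yw d (y / 2) * prob {\<omega>\<in>space M. y < \<bar>I1 t \<omega> - I2 t \<omega>\<bar>} \<le> 2 * \<kappa> + 2"
proof (rule field_le_epsilon)
  fix e :: real assume e: "0 < e"
  define Y where "Y = yw d (y / 2)"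
  have Y: "0 \<le> Y" unfolding Y_def by (rule yw_nonneg[OF d(1)])
  \<comment> \<open>\<open>c\<close> bounds the total factor with which \<open>p\<close> enters the
    final estimate; \<open>p\<close> is then chosen so that these contributions stay below
    \<open>e\<close>.\<close>
  define c where "c = 2 * Y + 8 * (2 * R + 2) / d"
  have c: "0 \<le> c" using Y R d by (simp add: c_def)
  define p where "p = e / (c + 1)"
  have p: "0 < p" "p * c \<le> e" using e c by (auto simp: p_def field_simps)
  \<comment> \<open>Two errors together must stay below \<open>d\<close>, for the weight to control
    the true difference, and below \<open>y / 2\<close>, so that a true difference above
    \<open>y\<close> leaves \<open>\<bar>J t\<bar>\<close> at least \<open>y / 2\<close>.\<close>
  define \<epsilon> where "\<epsilon> = min (d / 2) (y / 4)"
  have \<epsilon>: "0 < \<epsilon>" "\<epsilon> \<le> 1" "2 * \<epsilon> \<le> d" "2 * \<epsilon> \<le> y / 2" using d y by (auto simp: \<epsilon>_def)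
  obtain G1 J1 B1 where el1: "elementary G1 J1"
    and G1: "\<forall>\<omega>. (\<integral>\<^sup>+s\<in>{0..T}. ennreal ((G1 s \<omega>)\<^sup>2) \<partial>lborel) \<le> ennreal (2 * R + 2)"
    and B1: "B1 \<in> events" "prob B1 < p"
    and approx1: "\<forall>\<omega>\<in>space M - B1. (\<integral>\<^sup>+s\<in>{0..T}. ennreal ((H1 s \<omega>)\<^sup>2) \<partial>lborel) \<le> ennreal R \<longrightarrow>
      (\<integral>\<^sup>+s\<in>{0..T}. ennreal ((G1 s \<omega> - H1 s \<omega>)\<^sup>2) \<partial>lborel) \<le> ennreal \<epsilon> \<and>
      (\<forall>t\<in>{0..T}. \<bar>J1 t \<omega> - I1 t \<omega>\<bar> \<le> \<epsilon>)"
    using ito_approximation[OF ito(1) T R(1) \<epsilon>(1,2) p(1)] by blast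
  note HG1 = approx1[rule_format, THEN conjunct1] and IJ1 = approx1[rule_format, THEN conjunct2, rule_format]
  obtain G2 J2 B2 where el2: "elementary G2 J2"
    and G2: "\<forall>\<omega>. (\<integral>\<^sup>+s\<in>{0..T}. ennreal ((G2 s \<omega>)\<^sup>2) \<partial>lborel) \<le> ennreal (2 * R + 2)"
    and B2: "B2 \<in> events" "prob B2 < p"
    and approx2: "\<forall>\<omega>\<in>space M - B2. (\<integral>\<^sup>+s\<in>{0..T}. ennreal ((H2 s \<omega>)\<^sup>2) \<partial>lborel) \<le> ennreal R \<longrightarrow>
      (\<integral>\<^sup>+s\<in>{0..T}. ennreal ((G2 s \<omega> - H2 s \<omega>)\<^sup>2) \<partial>lborel) \<le> ennreal \<epsilon> \<and>
      (\<forall>t\<in>{0..T}. \<bar>J2 t \<omega> - I2 t \<omega>\<bar> \<le> \<epsilon>)"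
    using ito_approximation[OF ito(2) T R(1) \<epsilon>(1,2) p(1)] by blast
  note HG2 = approx2[rule_format, THEN conjunct1] and IJ2 = approx2[rule_format, THEN conjunct2, rule_format]
  define B where "B = B1 \<union> B2"
  have B [measurable]: "B \<in> events" and pB: "prob B \<le> 2 * p"
    using B1 B2 measure_Un_le[OF B1(1) B2(1)] by (auto simp: B_def)
  define G where "G s \<omega> = G1 s \<omega> - G2 s \<omega>" for s \<omega>
  define J where "J s \<omega> = J1 s \<omega> - J2 s \<omega>" for s \<omega>
  have el: "elementary G J"
    using elementary_add_scaled[OF el1 el2, of "-1"] by (simp add: G_def[abs_def] J_def[abs_def])
  define clamp where "clamp s = max 0 (min T s)" for s
  have clamp: "clamp s = s" if "s \<in> {0..T}" for s using that by (simp add: clamp_def)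
  have H1m [measurable]: "(\<lambda>(s, \<omega>). H1 (clamp s) \<omega>) \<in> borel_measurable (lborel \<Otimes>\<^sub>M M)"
    and H2m [measurable]: "(\<lambda>(s, \<omega>). H2 (clamp s) \<omega>) \<in> borel_measurable (lborel \<Otimes>\<^sub>M M)"
    using ito T unfolding clamp_def has_ito_integral_def
    by (blast intro: progressive_clamp_measurable order.strict_implies_order)+
  have G1m [measurable]: "(\<lambda>(s, \<omega>). G1 s \<omega>) \<in> borel_measurable (lborel \<Otimes>\<^sub>M M)"
    and G2m [measurable]: "(\<lambda>(s, \<omega>). G2 s \<omega>) \<in> borel_measurable (lborel \<Otimes>\<^sub>M M)"
    using el1 el2 by (auto simp: elementary_def)
  define w where "w s \<omega> = 1 / sqrt ((J s \<omega>)\<^sup>2 + d\<^sup>2)" for s \<omega>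
  have w: "0 \<le> w s \<omega>" "w s \<omega> \<le> 1 / d" "\<bar>J s \<omega>\<bar> * w s \<omega> \<le> 1" for s \<omega>
    unfolding w_def by (rule yw_bound2[OF d(1)])+
  \<comment> \<open>This crude bound holds on every path: it uses only the energy bound of the
    stopped integrands and the weight bound \<open>1 / d\<close>.\<close>
  have bad: "(\<integral>\<^sup>+s\<in>{0<..T}. ennreal (w s \<omega> * (G s \<omega>)\<^sup>2) \<partial>lborel) \<le> ennreal (4 * (2 * R + 2) / d)"
    if wM [measurable]: "\<omega> \<in> space M" for \<omega>
  proof -
    have "w s \<omega> * (G s \<omega>)\<^sup>2 \<le> 0 * 0 + 2 / d * ((G1 s \<omega>)\<^sup>2 + (G2 s \<omega>)\<^sup>2)" for s
    proof -
      have "(G s \<omega>)\<^sup>2 \<le> 2 * ((G1 s \<omega>)\<^sup>2 + (G2 s \<omega>)\<^sup>2)"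
        using zero_le_power2[of "G1 s \<omega> + G2 s \<omega>"] by (simp add: G_def power2_eq_square algebra_simps)
      then have "w s \<omega> * (G s \<omega>)\<^sup>2 \<le> 1 / d * (2 * ((G1 s \<omega>)\<^sup>2 + (G2 s \<omega>)\<^sup>2))"
        using w[of s \<omega>] d by (intro mult_mono) auto
      then show ?thesis by simp
    qed
    then have "(\<integral>\<^sup>+s\<in>{0<..T}. ennreal (w s \<omega> * (G s \<omega>)\<^sup>2) \<partial>lborel) \<le> ennreal (0 * 0 + 2 / d * (2 * (2 * R + 2)))"
      using R d by (intro nn_integral_combination_le[where f = "\<lambda>_. 0" and g = "\<lambda>s. (G1 s \<omega>)\<^sup>2" and h = "\<lambda>s. (G2 s \<omega>)\<^sup>2"]
          G1[rule_format] G2[rule_format]) auto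
    then show ?thesis by simp
  qed
  have good: "(\<integral>\<^sup>+s\<in>{0<..T}. ennreal (w s \<omega> * (G s \<omega>)\<^sup>2) \<partial>lborel) \<le> ennreal (4 * \<kappa> + 4)"
    if "\<omega> \<in> space M - B"
      and E1: "(\<integral>\<^sup>+s\<in>{0..T}. ennreal ((H1 s \<omega>)\<^sup>2) \<partial>lborel) \<le> ennreal R"
      and E2: "(\<integral>\<^sup>+s\<in>{0..T}. ennreal ((H2 s \<omega>)\<^sup>2) \<partial>lborel) \<le> ennreal R"
      and KH: "\<forall>s\<in>{0<..T}. (H1 s \<omega> - H2 s \<omega>)\<^sup>2 \<le> K s * \<bar>I1 s \<omega> - I2 s \<omega>\<bar>" for \<omega>
  proof -
    have wM [measurable]: "\<omega> \<in> space M" and w1: "\<omega> \<in> space M - B1" and w2: "\<omega> \<in> space M - B2"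
      using that(1) by (auto simp: B_def)
    have "(\<integral>\<^sup>+s\<in>{0<..T}. ennreal (w s \<omega> * (G s \<omega>)\<^sup>2) \<partial>lborel) \<le> ennreal (4 * \<kappa> + 4 / d * (2 * \<epsilon>))"
    proof (rule nn_integral_combination_le[where f = K and
          g = "\<lambda>s. (G1 s \<omega> - H1 (clamp s) \<omega>)\<^sup>2" and h = "\<lambda>s. (G2 s \<omega> - H2 (clamp s) \<omega>)\<^sup>2"])
      fix s assume s: "s \<in> {0<..T}"
      then have s': "s \<in> {0..T}" by simp
      have "\<bar>J s \<omega> - (I1 s \<omega> - I2 s \<omega>)\<bar> \<le> d"
        using IJ1[OF w1 E1 s'] IJ2[OF w2 E2 s'] \<epsilon>(3) unfolding J_def by linarith
      from weighted_square_le[OF w d(1) this K_nonneg KH[rule_format, OF s], of "G1 s \<omega> - H1 s \<omega>" "G2 s \<omega> - H2 s \<omega>"]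
      show "w s \<omega> * (G s \<omega>)\<^sup>2 \<le> 4 * K s + 4 / d * ((G1 s \<omega> - H1 (clamp s) \<omega>)\<^sup>2 + (G2 s \<omega> - H2 (clamp s) \<omega>)\<^sup>2)"
        by (simp add: G_def clamp[OF s'] algebra_simps)
    next
      have eq: "(\<integral>\<^sup>+s\<in>{0..T}. ennreal ((g s - h (clamp s) \<omega>)\<^sup>2) \<partial>lborel) =
          (\<integral>\<^sup>+s\<in>{0..T}. ennreal ((g s - h s \<omega>)\<^sup>2) \<partial>lborel)" for g :: "real \<Rightarrow> real" and h :: "real \<Rightarrow> 'a \<Rightarrow> real"
        by (intro nn_integral_cong) (auto simp: indicator_def clamp)
      show "(\<integral>\<^sup>+s\<in>{0..T}. ennreal ((G1 s \<omega> - H1 (clamp s) \<omega>)\<^sup>2) \<partial>lborel) \<le> ennreal \<epsilon>"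
        using HG1[OF w1 E1] by (simp only: eq[of "\<lambda>s. G1 s \<omega>" H1])
      show "(\<integral>\<^sup>+s\<in>{0..T}. ennreal ((G2 s \<omega> - H2 (clamp s) \<omega>)\<^sup>2) \<partial>lborel) \<le> ennreal \<epsilon>"
        using HG2[OF w2 E2] by (simp only: eq[of "\<lambda>s. G2 s \<omega>" H2])
    qed (use d \<epsilon> K_int K_nonneg in auto)
    also have "\<dots> \<le> ennreal (4 * \<kappa> + 4)"
      using d \<epsilon>(3) by (intro ennreal_leI) (simp add: field_simps)
    finally show ?thesis .
  qed
  \<comment> \<open>The good bound is integrated over the whole space, the crude one over
    \<open>B\<close> only.\<close>
  have "(\<integral>\<^sup>+\<omega>. (\<integral>\<^sup>+s\<in>{0<..T}. ennreal (w s \<omega> * (G s \<omega>)\<^sup>2) \<partial>lborel) \<partial>M) \<le>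
      (\<integral>\<^sup>+\<omega>. ennreal (4 * \<kappa> + 4) + ennreal (4 * (2 * R + 2) / d) * indicator B \<omega> \<partial>M)"
  proof (rule nn_integral_mono_AE)
    show "AE \<omega> in M. (\<integral>\<^sup>+s\<in>{0<..T}. ennreal (w s \<omega> * (G s \<omega>)\<^sup>2) \<partial>lborel) \<le>
        ennreal (4 * \<kappa> + 4) + ennreal (4 * (2 * R + 2) / d) * indicator B \<omega>"
      using R(2,3) K_bound AE_space
    proof eventually_elim
      case (elim \<omega>)
      show ?case
      proof (cases "\<omega> \<in> B")
        case True
        then show ?thesis using bad[OF elim(4)] by (simp add: add_increasing)
      next
        case False
        then show ?thesis using good[OF _ elim(1-3)] elim(4) by simp
      qed
    qed
  qed
  also have "\<dots> = ennreal (4 * \<kappa> + 4 + 4 * (2 * R + 2) / d * prob B)"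
    using R d K_int
    by (simp add: nn_integral_add nn_integral_cmult_indicator prob_space emeasure_eq_measure
        ennreal_mult[symmetric] ennreal_plus[symmetric] del: ennreal_plus)
  finally have main: "(\<integral>\<^sup>+\<omega>. (\<integral>\<^sup>+s\<in>{0<..T}. ennreal (w s \<omega> * (G s \<omega>)\<^sup>2) \<partial>lborel) \<partial>M) \<le>
      ennreal (4 * \<kappa> + 4 + 4 * (2 * R + 2) / d * prob B)" .
  define A where "A = {\<omega>\<in>space M. y / 2 \<le> \<bar>J t \<omega>\<bar>}"
  have Jt [measurable]: "J t \<in> borel_measurable M"
    using el t by (intro filtration_measurable[of _ t]) (auto simp: elementary_def)
  have [measurable]: "A \<in> events" unfolding A_def by measurable
  have "0 \<le> 4 * \<kappa> + 4 + 4 * (2 * R + 2) / d * prob B" using K_int R d by simp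
  then have "Y * prob A \<le> (4 * \<kappa> + 4 + 4 * (2 * R + 2) / d * prob B) / 2"
    using elementary_deviation[OF el d(1) _ t _ main[unfolded w_def], of "y / 2"] y
    by (simp add: Y_def A_def)
  also have "\<dots> = 2 * \<kappa> + 2 + 2 * (2 * R + 2) / d * prob B" by (simp add: field_simps)
  also have "\<dots> \<le> 2 * \<kappa> + 2 + 2 * (2 * R + 2) / d * (2 * p)"
    using pB R d by (intro add_left_mono mult_left_mono) auto
  finally have YA: "Y * prob A \<le> 2 * \<kappa> + 2 + 2 * (2 * R + 2) / d * (2 * p)" .
  have "prob {\<omega>\<in>space M. y < \<bar>I1 t \<omega> - I2 t \<omega>\<bar>} \<le> prob (B \<union> A)"
  proof (rule finite_measure_mono_AE)
    show "AE \<omega> in M. \<omega> \<in> {\<omega>\<in>space M. y < \<bar>I1 t \<omega> - I2 t \<omega>\<bar>} \<longrightarrow> \<omega> \<in> B \<union> A"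
      using R(2,3)
    proof eventually_elim
      case (elim \<omega>)
      have t': "t \<in> {0..T}" using t by simp
      show ?case
      proof (intro impI, rule ccontr)
        assume a: "\<omega> \<in> {\<omega>\<in>space M. y < \<bar>I1 t \<omega> - I2 t \<omega>\<bar>}" and b: "\<omega> \<notin> B \<union> A"
        then have "\<omega> \<in> space M - B1" "\<omega> \<in> space M - B2" "\<bar>J t \<omega>\<bar> < y / 2" by (auto simp: B_def A_def)
        note w = this
        have "y < \<bar>I1 t \<omega> - I2 t \<omega>\<bar>" using a by simp
        then show False
          using IJ1[OF w(1) elim(1) t'] IJ2[OF w(2) elim(2) t'] w(3) \<epsilon>(4) unfolding J_def by linarith
      qed
    qed
  qed measurable
  also have "\<dots> \<le> 2 * p + prob A"
    using measure_Un_le[of B M A] pB by simp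
  finally have "Y * prob {\<omega>\<in>space M. y < \<bar>I1 t \<omega> - I2 t \<omega>\<bar>} \<le> Y * (2 * p + prob A)"
    using Y by (rule mult_left_mono)
  also have "\<dots> \<le> 2 * \<kappa> + 2 + (Y * (2 * p) + 2 * (2 * R + 2) / d * (2 * p))"
    using YA by (simp add: algebra_simps)
  also have "Y * (2 * p) + 2 * (2 * R + 2) / d * (2 * p) \<le> p * c"
  proof -
    have "p * c - (Y * (2 * p) + 2 * (2 * R + 2) / d * (2 * p)) = 4 * (2 * R + 2) / d * p"
      by (simp add: c_def field_simps)
    also have "\<dots> \<ge> 0" using R d p by simp
    finally show ?thesis by simp
  qed
  finally show "yw d (y / 2) * prob {\<omega>\<in>space M. y < \<bar>I1 t \<omega> - I2 t \<omega>\<bar>} \<le> 2 * \<kappa> + 2 + e"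
    using p(2) by (simp add: Y_def)
qed

text \<open>Letting \<open>d\<close> tend to \<open>0\<close> in
  \<open>ito_difference_deviation\<close> forces each deviation probability to vanish. Equality at
  rational times then extends to all times by continuity.\<close>

lemma ito_integrals_indistinguishable:
  assumes T: "0 < T" and ito: "has_ito_integral M F T W H1 I1" "has_ito_integral M F T W H2 I2"
    and R: "0 \<le> R" "AE \<omega> in M. (\<integral>\<^sup>+s\<in>{0..T}. ennreal ((H1 s \<omega>)\<^sup>2) \<partial>lborel) \<le> ennreal R"
      "AE \<omega> in M. (\<integral>\<^sup>+s\<in>{0..T}. ennreal ((H2 s \<omega>)\<^sup>2) \<partial>lborel) \<le> ennreal R"
    and K: "K \<in> borel_measurable lborel" "\<And>s. 0 \<le> K s" "0 \<le> \<kappa>"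
      "(\<integral>\<^sup>+s\<in>{0..T}. ennreal (K s) \<partial>lborel) \<le> ennreal \<kappa>"
      "AE \<omega> in M. \<forall>s\<in>{0<..T}. (H1 s \<omega> - H2 s \<omega>)\<^sup>2 \<le> K s * \<bar>I1 s \<omega> - I2 s \<omega>\<bar>"
  shows "AE \<omega> in M. \<forall>t\<in>{0..T}. I1 t \<omega> = I2 t \<omega>"
proof -
  have zero: "prob {\<omega>\<in>space M. y < \<bar>I1 t \<omega> - I2 t \<omega>\<bar>} = 0" if y: "0 < y" and t: "0 \<le> t" "t \<le> T" for y t
  proof (rule ccontr)
    assume "prob {\<omega>\<in>space M. y < \<bar>I1 t \<omega> - I2 t \<omega>\<bar>} \<noteq> 0"
    then have pos: "prob {\<omega>\<in>space M. y < \<bar>I1 t \<omega> - I2 t \<omega>\<bar>} > 0" (is "?q > 0")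
      by (simp add: zero_less_measure_iff)
    have "0 < y / 2 * ?q" using y pos by simp
    then obtain n where n: "2 * \<kappa> + 2 < real n * (y / 2 * ?q)" using reals_Archimedean3 by blast
    \<comment> \<open>With this choice \<open>ln (y / 2 / d) - 1\<close> is at least
      \<open>n\<close>, so \<open>yw_lower\<close> gives
      \<open>yw d (y / 2) \<ge> y / 2 * n\<close>, contradicting the fixed bound.\<close>
    define d where "d = min 1 (y / 2 * exp (- real n - 1))"
    have d: "0 < d" "d \<le> 1" using y by (auto simp: d_def)
    have "real n + 1 \<le> ln (y / 2 / d)"
    proof -
      have "exp (real n + 1) * d \<le> exp (real n + 1) * (y / 2 * exp (- real n - 1))"
        by (intro mult_left_mono) (auto simp: d_def)
      also have "\<dots> = y / 2" by (simp add: exp_minus exp_add exp_diff field_simps)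
      finally have "exp (real n + 1) \<le> y / 2 / d" using d by (simp add: field_simps)
      then show ?thesis using d y by (subst ln_ge_iff) auto
    qed
    then have "y / 2 * real n \<le> y / 2 * (ln (y / 2 / d) - 1)" using y by (intro mult_left_mono) auto
    also have "\<dots> \<le> yw d (y / 2)" using d y by (intro yw_lower) auto
    finally have "y / 2 * real n \<le> yw d (y / 2)" .
    then have "y / 2 * real n * ?q \<le> yw d (y / 2) * ?q" by (intro mult_right_mono) auto
    also have "\<dots> \<le> 2 * \<kappa> + 2"
      by (rule ito_difference_deviation[OF T ito R K d y t])
    finally show False using n by (simp add: mult_ac)
  qed
  have Im: "I1 t \<in> borel_measurable M" "I2 t \<in> borel_measurable M" if "t \<in> {0..T}" for t
  proof -
    have "adapted F T I1" "adapted F T I2" using ito unfolding has_ito_integral_def by blast+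
    then have "I1 t \<in> borel_measurable (F t)" "I2 t \<in> borel_measurable (F t)"
      using that unfolding adapted_def by blast+
    then show "I1 t \<in> borel_measurable M" "I2 t \<in> borel_measurable M"
      using that by (auto intro: filtration_measurable)
  qed
  have "AE \<omega> in M. I1 t \<omega> = I2 t \<omega>" if t: "t \<in> {0..T}" for t
  proof -
    note [measurable] = Im[OF t]
    have "AE \<omega> in M. \<not> 1 / real (Suc n) < \<bar>I1 t \<omega> - I2 t \<omega>\<bar>" for n
      by (rule AE_I[of _ _ "{\<omega>\<in>space M. 1 / real (Suc n) < \<bar>I1 t \<omega> - I2 t \<omega>\<bar>}"])
        (use zero[of "1 / real (Suc n)" t] t in \<open>auto simp: emeasure_eq_measure\<close>)
    then have "AE \<omega> in M. \<forall>n. \<not> 1 / real (Suc n) < \<bar>I1 t \<omega> - I2 t \<omega>\<bar>"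
      by (subst AE_all_countable) blast
    then show ?thesis
    proof eventually_elim
      case (elim \<omega>)
      then show ?case using nat_approx_posE[of "\<bar>I1 t \<omega> - I2 t \<omega>\<bar>"] by fastforce
    qed
  qed
  then have "AE \<omega> in M. \<forall>q\<in>\<rat> \<inter> {0<..<T}. I1 q \<omega> = I2 q \<omega>"
    by (subst AE_ball_countable) (auto simp: countable_rat countable_Int1)
  then show ?thesis
    using AE_space
  proof eventually_elim
    case (elim \<omega>)
    have cont: "continuous_on {0..T} (\<lambda>t. \<bar>I1 t \<omega> - I2 t \<omega>\<bar>)"
    proof -
      have "continuous_paths M T I1" "continuous_paths M T I2" using ito unfolding has_ito_integral_def by blast+
      then show ?thesis using elim(2) by (auto simp: continuous_paths_def intro!: continuous_intros)
    qed
    have "\<not> 0 < (SUP t\<in>{0..T}. \<bar>I1 t \<omega> - I2 t \<omega>\<bar>)"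
      using elim(1) by (simp add: less_SUP_iff_rational[OF T cont])
    moreover have "bdd_above ((\<lambda>t. \<bar>I1 t \<omega> - I2 t \<omega>\<bar>) ` {0..T})"
      using compact_continuous_image[OF cont] by (auto intro: bounded_imp_bdd_above compact_imp_bounded)
    ultimately show ?case using cSUP_upper[of _ "{0..T}" "\<lambda>t. \<bar>I1 t \<omega> - I2 t \<omega>\<bar>"] by fastforce
  qed
qed

end

subsection \<open>The Barenblatt coefficient\<close>

text \<open>Averages of \<open>f\<close> over small balls around a continuity point converge to its
  value there. The identity is thus pointwise rather than almost everywhere, which allows evaluation
  along a path.\<close>

lemma lebesgue_density_eq:
  fixes f :: "real \<Rightarrow> real"
  assumes X: "distributed M lborel X (\<lambda>x. ennreal (f x))" and cont: "isCont f x"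
    and nonneg: "0 \<le> f x"
  shows "lebesgue_density (distr M borel X) x = f x"
proof -
  have [measurable]: "(\<lambda>x. ennreal (f x)) \<in> borel_measurable lborel"
    using X by (simp add: distributed_def)
  have "distr M borel X = distr M lborel X" by (rule distr_cong) auto
  also have "\<dots> = density lborel (\<lambda>x. ennreal (f x))" using X by (simp add: distributed_def)
  finally have law: "distr M borel X = density lborel (\<lambda>x. ennreal (f x))" .
  have "(ball_ratio (distr M borel X) x \<longlongrightarrow> f x) (at_right 0)"
  proof (rule tendstoI)
    fix e :: real assume e: "0 < e"
    then obtain \<delta> where \<delta>: "0 < \<delta>" "\<And>y. \<bar>y - x\<bar> < \<delta> \<Longrightarrow> \<bar>f y - f x\<bar> < e / 2"
      using cont[unfolded continuous_at_eps_delta, rule_format, of "e / 2"] by (auto simp: dist_real_def)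
    have "dist (ball_ratio (distr M borel X) x r) (f x) < e" if r: "0 < r" "r < \<delta>" for r
    proof -
      have near: "f x - e / 2 \<le> f y \<and> f y \<le> f x + e / 2" if "y \<in> ball x r" for y
      proof -
        have "\<bar>y - x\<bar> < \<delta>" using that r by (simp add: dist_real_def abs_minus_commute)
        from \<delta>(2)[OF this] show ?thesis unfolding abs_less_iff by simp
      qed
      have len: "emeasure lborel (ball z r) = ennreal (2 * r)" for z :: real
        using r by (simp add: ball_eq_greaterThanLessThan)
      have em: "emeasure (distr M borel X) (ball x r) = (\<integral>\<^sup>+y\<in>ball x r. ennreal (f y) \<partial>lborel)"
        unfolding law by (rule emeasure_density) auto
      have up: "emeasure (distr M borel X) (ball x r) \<le> ennreal ((f x + e / 2) * (2 * r))"
      proof -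
        have "(\<integral>\<^sup>+y\<in>ball x r. ennreal (f y) \<partial>lborel) \<le> (\<integral>\<^sup>+y\<in>ball x r. ennreal (f x + e / 2) \<partial>lborel)"
          using near by (intro nn_integral_mono) (auto simp: indicator_def intro!: ennreal_leI)
        also have "\<dots> = ennreal (f x + e / 2) * ennreal (2 * r)"
          by (subst nn_integral_cmult_indicator) (auto simp: len)
        also have "\<dots> = ennreal ((f x + e / 2) * (2 * r))"
          using nonneg e r by (intro ennreal_mult[symmetric]) auto
        finally show ?thesis by (simp add: em)
      qed
      have low: "ennreal ((f x - e / 2) * (2 * r)) \<le> emeasure (distr M borel X) (ball x r)"
      proof -
        \<comment> \<open>\<open>f x - e / 2\<close> may be negative; both sides are then
          \<open>0\<close>, and the product rule needs only the sign of
          \<open>2 * r\<close>.\<close>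
        have "ennreal ((f x - e / 2) * (2 * r)) = ennreal (f x - e / 2) * ennreal (2 * r)"
          using r by (intro ennreal_mult'') auto
        also have "\<dots> = (\<integral>\<^sup>+y\<in>ball x r. ennreal (f x - e / 2) \<partial>lborel)"
          by (subst nn_integral_cmult_indicator) (auto simp: len)
        also have "\<dots> \<le> (\<integral>\<^sup>+y\<in>ball x r. ennreal (f y) \<partial>lborel)"
          using near by (intro nn_integral_mono) (auto simp: indicator_def intro!: ennreal_leI)
        finally show ?thesis by (simp add: em)
      qed
      have fin: "emeasure (distr M borel X) (ball x r) = ennreal (measure (distr M borel X) (ball x r))"
        using up by (intro emeasure_eq_ennreal_measure) (auto simp: top_unique)
      have "(f x - e / 2) * (2 * r) \<le> measure (distr M borel X) (ball x r)"
        using low unfolding fin by (subst (asm) ennreal_le_iff) auto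
      moreover have "measure (distr M borel X) (ball x r) \<le> (f x + e / 2) * (2 * r)"
        using up nonneg e r unfolding fin by (subst (asm) ennreal_le_iff) auto
      moreover have "measure lborel (ball (0::real) r) = 2 * r"
        using r by (simp add: measure_def len)
      ultimately have "f x - e / 2 \<le> ball_ratio (distr M borel X) x r"
        "ball_ratio (distr M borel X) x r \<le> f x + e / 2"
        using r by (auto simp: ball_ratio_def pos_le_divide_eq pos_divide_le_eq)
      then show ?thesis using e by (simp add: dist_real_def)
    qed
    then show "\<forall>\<^sub>F r in at_right 0. dist (ball_ratio (distr M borel X) x r) (f x) < e"
      unfolding eventually_at_right[OF \<delta>(1)] using \<delta>(1) by blast
  qed
  then show ?thesis
    unfolding lebesgue_density_def by (auto intro!: tendsto_Lim)
qed

section \<open>Regularity of the Barenblatt coefficient in space and time\<close>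

text \<open>Truncating the parabola amounts to cutting \<open>\<bar>v\<bar>\<close> off at its zero
  \<open>c = sqrt (C / k)\<close>. The difference then factors with a sum of at most
  \<open>2 * c\<close>, and \<open>k * c = sqrt (C * k)\<close>.\<close>

lemma truncated_parabola_lipschitz:
  fixes C k z w :: real
  assumes "0 < C" "0 < k"
  shows "\<bar>max (C - k * z\<^sup>2) 0 - max (C - k * w\<^sup>2) 0\<bar> \<le> 2 * sqrt (C * k) * \<bar>z - w\<bar>"
proof -
  define c where "c = sqrt (C / k)"
  have c: "0 \<le> c" "c\<^sup>2 = C / k" using assms by (auto simp: c_def)
  have kc: "k * c = sqrt (C * k)"
    using assms by (intro real_sqrt_unique[symmetric]) (auto simp: c power_mult_distrib power2_eq_square[of k] c_def)
  have rep: "max (C - k * v\<^sup>2) 0 = k * (c\<^sup>2 - (min \<bar>v\<bar> c)\<^sup>2)" for v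
  proof (cases "\<bar>v\<bar> \<le> c")
    case True
    then have "v\<^sup>2 \<le> c\<^sup>2" using power_mono[OF True, of 2] by simp
    then have "k * v\<^sup>2 \<le> C" using assms by (simp add: c field_simps)
    with True show ?thesis using assms by (simp add: c field_simps)
  next
    case False
    then have "c\<^sup>2 \<le> v\<^sup>2" using power_mono[of c "\<bar>v\<bar>" 2] c by simp
    then have "C \<le> k * v\<^sup>2" using assms by (simp add: c field_simps)
    with False show ?thesis by simp
  qed
  define p q where "p = min \<bar>z\<bar> c" and "q = min \<bar>w\<bar> c"
  have pq: "0 \<le> p" "p \<le> c" "0 \<le> q" "q \<le> c" using c by (auto simp: p_def q_def)
  have "\<bar>max (C - k * z\<^sup>2) 0 - max (C - k * w\<^sup>2) 0\<bar> = k * (\<bar>q - p\<bar> * (q + p))"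
  proof -
    have "max (C - k * z\<^sup>2) 0 - max (C - k * w\<^sup>2) 0 = k * ((q - p) * (q + p))"
      unfolding rep p_def[symmetric] q_def[symmetric] by (simp add: power2_eq_square algebra_simps)
    then show ?thesis using assms pq by (simp add: abs_mult)
  qed
  also have "\<dots> \<le> k * (\<bar>z - w\<bar> * (2 * c))"
    using assms pq by (intro mult_left_mono mult_mono) (auto simp: p_def q_def)
  also have "\<dots> = 2 * sqrt (C * k) * \<bar>z - w\<bar>" by (simp add: kc[symmetric])
  finally show ?thesis .
qed

text \<open>This turns Lipschitz continuity of the variance into Hoelder continuity of order
  \<open>1/2\<close> of the coefficient, the Yamada--Watanabe condition.\<close>

lemma sqrt_diff_square_le:
  assumes "0 \<le> a" "0 \<le> b"
  shows "(sqrt a - sqrt b)\<^sup>2 \<le> \<bar>a - b\<bar>"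
proof -
  have "(sqrt a - sqrt b)\<^sup>2 = \<bar>sqrt a - sqrt b\<bar> * \<bar>sqrt a - sqrt b\<bar>"
    by (simp add: power2_eq_square)
  also have "\<dots> \<le> \<bar>sqrt a - sqrt b\<bar> * \<bar>sqrt a + sqrt b\<bar>"
    using real_sqrt_ge_zero[OF assms(1)] real_sqrt_ge_zero[OF assms(2)]
    by (intro mult_left_mono abs_leI) (linarith | simp)+
  also have "\<dots> = \<bar>a - b\<bar>"
  proof -
    have "(sqrt a - sqrt b) * (sqrt a + sqrt b) = a - b" using assms by (simp add: algebra_simps)
    then show ?thesis by (simp only: abs_mult[symmetric])
  qed
  finally show ?thesis .
qed

lemma nn_integral_powr_from_0:
  fixes a c T :: real
  assumes "-1 < a" "0 \<le> T" "0 \<le> c"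
  shows "(\<integral>\<^sup>+s\<in>{0..T}. ennreal (c * s powr a) \<partial>lborel) = ennreal (c * (T powr (a + 1) / (a + 1)))"
proof -
  have "((\<lambda>s. c * s powr a) has_integral c * (T powr (a + 1) / (a + 1))) {0..T}"
    by (rule has_integral_mult_right[OF has_integral_powr_from_0[OF assms(1,2)]])
  from nn_integral_has_integral_lebesgue[OF _ this] assms(3)
  have "(\<integral>\<^sup>+s. ennreal (indicator {0..T} s * (c * s powr a)) \<partial>lborel) = ennreal (c * (T powr (a + 1) / (a + 1)))"
    by simp
  then show ?thesis by (subst nn_integral_set_ennreal) (simp add: mult_ac)
qed

text \<open>This is the squared diffusion coefficient at the Barenblatt profile: the power
  \<open>m - 1\<close> cancels the exponent \<open>1 / (m - 1)\<close> and leaves a truncated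
  parabola. The factor \<open>(m - 1) / (2 * m * (m + 1))\<close> is \<open>k\<close> with
  \<open>\<alpha> = 1 / (m + 1)\<close> inserted.\<close>

definition barenblatt_variance :: "real \<Rightarrow> real \<Rightarrow> real \<Rightarrow> real \<Rightarrow> real \<Rightarrow> real" where
  "barenblatt_variance m C x0 t x = 2 * (t powr (- ((m - 1) / (m + 1))) *
     max (C - (m - 1) / (2 * m * (m + 1)) * ((x - x0) * t powr (- (1 / (m + 1))))\<^sup>2) 0)"

lemma barenblatt_variance_nonneg: "0 \<le> barenblatt_variance m C x0 t x"
  by (simp add: barenblatt_variance_def)

lemma diffusion_coefficient_barenblatt:
  assumes X: "distributed M lborel X (\<lambda>x. ennreal (barenblatt m C x0 t x))" and m: "1 < m" and t: "0 < t"
  shows "diffusion_coefficient m (distr M borel X) x = sqrt (barenblatt_variance m C x0 t x)"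
proof -
  define q where "q x = max (C - (m - 1) / (2 * m * (m + 1)) * ((x - x0) * t powr (- (1 / (m + 1))))\<^sup>2) 0" for x
  have b: "barenblatt m C x0 t x = t powr (- (1 / (m + 1))) * q x powr (1 / (m - 1))" for x
  proof -
    have k: "1 / (m + 1) * (m - 1) / (2 * m) = (m - 1) / (2 * m * (m + 1))" using m by (simp add: field_simps)
    show ?thesis unfolding barenblatt_def Let_def q_def power2_abs k by (rule refl)
  qed
  have q: "0 \<le> q x" for x by (simp add: q_def)
  \<comment> \<open>As \<open>1 / (m - 1)\<close> is positive, the profile is continuous even at the
    edge of its support, so the density is identified at every point.\<close>
  have "continuous_on UNIV (\<lambda>x. t powr (- (1 / (m + 1))) * q x powr (1 / (m - 1)))"
    by (intro continuous_intros continuous_on_powr') (use m in \<open>auto simp: q_def intro!: continuous_intros\<close>)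
  then have "isCont (barenblatt m C x0 t) x"
    unfolding b[abs_def] by (simp add: continuous_on_eq_continuous_at)
  then have "lebesgue_density (distr M borel X) x = barenblatt m C x0 t x"
    by (rule lebesgue_density_eq[OF X]) (simp add: b)
  moreover have "\<bar>barenblatt m C x0 t x\<bar> powr (m - 1) = t powr (- ((m - 1) / (m + 1))) * q x"
  proof -
    have "\<bar>barenblatt m C x0 t x\<bar> = t powr (- (1 / (m + 1))) * q x powr (1 / (m - 1))"
      by (simp add: b abs_of_nonneg)
    then show ?thesis
      using m q[of x] by (simp add: powr_mult powr_powr)
  qed
  ultimately show ?thesis
    by (simp add: diffusion_coefficient_def barenblatt_variance_def q_def)
qed

lemma barenblatt_variance_le:
  assumes "1 < m" "0 < C"
  shows "barenblatt_variance m C x0 t x \<le> 2 * C * t powr (- ((m - 1) / (m + 1)))"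
proof -
  have "max (C - (m - 1) / (2 * m * (m + 1)) * z\<^sup>2) 0 \<le> C" for z
    using assms by simp
  then have "t powr (- ((m - 1) / (m + 1))) *
     max (C - (m - 1) / (2 * m * (m + 1)) * ((x - x0) * t powr (- (1 / (m + 1))))\<^sup>2) 0 \<le>
     t powr (- ((m - 1) / (m + 1))) * C"
    by (rule mult_left_mono) simp
  then show ?thesis by (simp add: barenblatt_variance_def mult_ac)
qed

text \<open>The rescaled space variable adds a factor \<open>t powr (- (1 / (m + 1)))\<close> to the
  one in front, which gives the exponent \<open>- (m / (m + 1))\<close>, still above
  \<open>-1\<close>.\<close>

lemma barenblatt_variance_lipschitz:
  assumes m: "1 < m" and C: "0 < C"
  shows "\<bar>barenblatt_variance m C x0 t x - barenblatt_variance m C x0 t y\<bar> \<le>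
    4 * sqrt (C * ((m - 1) / (2 * m * (m + 1)))) * t powr (- (m / (m + 1))) * \<bar>x - y\<bar>"
proof -
  define a where "a = t powr (- (1 / (m + 1)))"
  define b where "b = t powr (- ((m - 1) / (m + 1)))"
  define k where "k = (m - 1) / (2 * m * (m + 1))"
  have k: "0 < k" using m by (simp add: k_def)
  have ab: "b * a = t powr (- (m / (m + 1)))"
    unfolding a_def b_def powr_add[symmetric] using m by (simp add: field_simps)
  have "\<bar>barenblatt_variance m C x0 t x - barenblatt_variance m C x0 t y\<bar> =
      2 * (b * \<bar>max (C - k * ((x - x0) * a)\<^sup>2) 0 - max (C - k * ((y - x0) * a)\<^sup>2) 0\<bar>)"
  proof -
    have "barenblatt_variance m C x0 t x - barenblatt_variance m C x0 t y =
        2 * (b * (max (C - k * ((x - x0) * a)\<^sup>2) 0 - max (C - k * ((y - x0) * a)\<^sup>2) 0))"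
      unfolding barenblatt_variance_def a_def[symmetric] b_def[symmetric] k_def[symmetric]
      by (simp add: right_diff_distrib)
    then show ?thesis by (simp add: abs_mult b_def)
  qed
  also have "\<dots> \<le> 2 * (b * (2 * sqrt (C * k) * \<bar>(x - x0) * a - (y - x0) * a\<bar>))"
    by (intro mult_left_mono truncated_parabola_lipschitz C k) (auto simp: b_def)
  also have "\<bar>(x - x0) * a - (y - x0) * a\<bar> = a * \<bar>x - y\<bar>"
    by (simp add: left_diff_distrib[symmetric] abs_mult a_def)
  also have "2 * (b * (2 * sqrt (C * k) * (a * \<bar>x - y\<bar>))) = 4 * sqrt (C * k) * (b * a) * \<bar>x - y\<bar>"
    by simp
  finally show ?thesis unfolding ab k_def .
qed

text \<open>The profile is bounded in space and its time factor has exponent above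
  \<open>-1\<close>, so the energy has a deterministic bound on every path.\<close>

lemma barenblatt_energy_le:
  assumes m: "1 < m" and C: "0 < C" and T: "0 < T"
    and X: "\<And>t. t \<in> {0<..T} \<Longrightarrow> distributed M lborel (X t) (\<lambda>x. ennreal (barenblatt m C x0 t x))"
  shows "(\<integral>\<^sup>+s\<in>{0..T}. ennreal ((diffusion_coefficient m (distr M borel (X s)) (X s \<omega>))\<^sup>2) \<partial>lborel) \<le>
    ennreal (2 * C * (T powr (2 / (m + 1)) / (2 / (m + 1))))"
proof -
  have "(\<integral>\<^sup>+s\<in>{0..T}. ennreal ((diffusion_coefficient m (distr M borel (X s)) (X s \<omega>))\<^sup>2) \<partial>lborel) \<le>
      (\<integral>\<^sup>+s\<in>{0..T}. ennreal (2 * C * s powr (- ((m - 1) / (m + 1)))) \<partial>lborel)"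
  proof (rule nn_integral_mono_AE)
    show "AE s in lborel. ennreal ((diffusion_coefficient m (distr M borel (X s)) (X s \<omega>))\<^sup>2) * indicator {0..T} s \<le>
        ennreal (2 * C * s powr (- ((m - 1) / (m + 1)))) * indicator {0..T} s"
      \<comment> \<open>Time \<open>0\<close> is discarded: the law has the Barenblatt density at
        positive times only.\<close>
      using AE_lborel_singleton[of 0]
    proof eventually_elim
      case (elim s)
      show ?case
      proof (cases "s \<in> {0..T}")
        case True
        with elim have s: "s \<in> {0<..T}" by simp
        then have "(diffusion_coefficient m (distr M borel (X s)) (X s \<omega>))\<^sup>2 = barenblatt_variance m C x0 s (X s \<omega>)"
          using diffusion_coefficient_barenblatt[OF X[OF s] m] by (simp add: barenblatt_variance_nonneg)
        then show ?thesis using True barenblatt_variance_le[OF m C] by (simp add: ennreal_leI)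
      qed simp
    qed
  qed
  also have "\<dots> = ennreal (2 * C * (T powr (- ((m - 1) / (m + 1)) + 1) / (- ((m - 1) / (m + 1)) + 1)))"
    using m C T by (intro nn_integral_powr_from_0) (auto simp: field_simps)
  also have "- ((m - 1) / (m + 1)) + 1 = 2 / (m + 1)" using m by (simp add: field_simps)
  finally show ?thesis .
qed

section \<open>Pathwise uniqueness for the Barenblatt equation\<close>

theorem theorem4p3:
  fixes m x0 C T :: real
    and M :: "'a measure" and F :: "real \<Rightarrow> 'a measure"
    and W X Y :: "real \<Rightarrow> 'a \<Rightarrow> real"
  assumes "m > 1"
    and "C > 0"
    and "\<And>t. t > 0 \<Longrightarrow> has_bochner_integral lborel (barenblatt m C x0 t) 1"
    and "T > 0"
    and "weak_solution M F T W (diffusion_coefficient m) (barenblatt m C x0) x0 X"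
    and "weak_solution M F T W (diffusion_coefficient m) (barenblatt m C x0) x0 Y"
    and "AE \<omega> in M. X 0 \<omega> = Y 0 \<omega>"
  shows "AE \<omega> in M. (SUP t\<in>{0..T}. \<bar>X t \<omega> - Y t \<omega>\<bar>) = 0"
proof -
  note m = assms(1) and C = assms(2) and T = assms(4)
  interpret X: weak_solution M F T W "diffusion_coefficient m" "barenblatt m C x0" x0 X by (rule assms(5))
  interpret Y: weak_solution M F T W "diffusion_coefficient m" "barenblatt m C x0" x0 Y by (rule assms(6))
  obtain I where I: "has_ito_integral M F T W (\<lambda>t \<omega>. diffusion_coefficient m (distr M borel (X t)) (X t \<omega>)) I"
    and XI: "AE \<omega> in M. \<forall>t\<in>{0..T}. X t \<omega> = X 0 \<omega> + I t \<omega>"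
    using X.equation by blast
  obtain J where J: "has_ito_integral M F T W (\<lambda>t \<omega>. diffusion_coefficient m (distr M borel (Y t)) (Y t \<omega>)) J"
    and YJ: "AE \<omega> in M. \<forall>t\<in>{0..T}. Y t \<omega> = Y 0 \<omega> + J t \<omega>"
    using Y.equation by blast
  define c where "c = 4 * sqrt (C * ((m - 1) / (2 * m * (m + 1))))"
  have c: "0 \<le> c" using m C by (simp add: c_def)
  have "AE \<omega> in M. \<forall>t\<in>{0..T}. I t \<omega> = J t \<omega>"
  proof (rule X.ito_integrals_indistinguishable[OF T I J])
    show "0 \<le> 2 * C * (T powr (2 / (m + 1)) / (2 / (m + 1)))" using m C by simp
    show "AE \<omega> in M. (\<integral>\<^sup>+s\<in>{0..T}. ennreal ((diffusion_coefficient m (distr M borel (X s)) (X s \<omega>))\<^sup>2) \<partial>lborel) \<le>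
        ennreal (2 * C * (T powr (2 / (m + 1)) / (2 / (m + 1))))"
      by (intro AE_I2 barenblatt_energy_le[OF m C T X.marginal_law])
    show "AE \<omega> in M. (\<integral>\<^sup>+s\<in>{0..T}. ennreal ((diffusion_coefficient m (distr M borel (Y s)) (Y s \<omega>))\<^sup>2) \<partial>lborel) \<le>
        ennreal (2 * C * (T powr (2 / (m + 1)) / (2 / (m + 1))))"
      by (intro AE_I2 barenblatt_energy_le[OF m C T Y.marginal_law])
    show "(\<lambda>s. c * s powr (- (m / (m + 1)))) \<in> borel_measurable lborel" by measurable
    show "0 \<le> c * s powr (- (m / (m + 1)))" for s using c by simp
    show "(\<integral>\<^sup>+s\<in>{0..T}. ennreal (c * s powr (- (m / (m + 1)))) \<partial>lborel) \<le>
        ennreal (c * (T powr (- (m / (m + 1)) + 1) / (- (m / (m + 1)) + 1)))"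
    proof (rule eq_refl, rule nn_integral_powr_from_0)
      show "-1 < - (m / (m + 1))" using m by (simp add: field_simps)
    qed (use c T in simp_all)
    show "0 \<le> c * (T powr (- (m / (m + 1)) + 1) / (- (m / (m + 1)) + 1))"
    proof -
      have "- (m / (m + 1)) + 1 = 1 / (m + 1)" using m by (simp add: field_simps)
      then show ?thesis using m c by simp
    qed
    show "AE \<omega> in M. \<forall>s\<in>{0<..T}. (diffusion_coefficient m (distr M borel (X s)) (X s \<omega>) -
        diffusion_coefficient m (distr M borel (Y s)) (Y s \<omega>))\<^sup>2 \<le> c * s powr (- (m / (m + 1))) * \<bar>I s \<omega> - J s \<omega>\<bar>"
      using XI YJ assms(7)
    proof eventually_elim
      case (elim \<omega>)
      show ?case
      proof
        fix s assume s: "s \<in> {0<..T}"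
        then have "s \<in> {0..T}" by simp
        \<comment> \<open>Since the initial values agree, the difference of the solutions equals
          that of the Ito integrals, so the Lipschitz bound can be stated in terms of the
          latter.\<close>
        then have "X s \<omega> - Y s \<omega> = I s \<omega> - J s \<omega>"
          using elim(1)[rule_format, of s] elim(2)[rule_format, of s] elim(3) by linarith
        moreover have "(sqrt (barenblatt_variance m C x0 s (X s \<omega>)) - sqrt (barenblatt_variance m C x0 s (Y s \<omega>)))\<^sup>2 \<le>
            \<bar>barenblatt_variance m C x0 s (X s \<omega>) - barenblatt_variance m C x0 s (Y s \<omega>)\<bar>"
          by (intro sqrt_diff_square_le barenblatt_variance_nonneg)
        moreover have "\<dots> \<le> c * s powr (- (m / (m + 1))) * \<bar>X s \<omega> - Y s \<omega>\<bar>"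
          unfolding c_def by (rule barenblatt_variance_lipschitz[OF m C])
        ultimately show "(diffusion_coefficient m (distr M borel (X s)) (X s \<omega>) -
            diffusion_coefficient m (distr M borel (Y s)) (Y s \<omega>))\<^sup>2 \<le> c * s powr (- (m / (m + 1))) * \<bar>I s \<omega> - J s \<omega>\<bar>"
          using s diffusion_coefficient_barenblatt[OF X.marginal_law[OF s] m]
            diffusion_coefficient_barenblatt[OF Y.marginal_law[OF s] m] by simp
      qed
    qed
  qed
  then show ?thesis
    using XI YJ assms(7)
  proof eventually_elim
    case (elim \<omega>)
    have "\<bar>X t \<omega> - Y t \<omega>\<bar> = 0" if "t \<in> {0..T}" for t
      using elim(1)[rule_format, OF that] elim(2)[rule_format, OF that] elim(3)[rule_format, OF that] elim(4)
      by linarith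
    \<comment> \<open>The image is that of a constant; as \<open>T > 0\<close> the index set is
      nonempty and the supremum is that constant.\<close>
    then have "(\<lambda>t. \<bar>X t \<omega> - Y t \<omega>\<bar>) ` {0..T} = (\<lambda>_. 0) ` {0..T}" by (rule image_cong[OF refl])
    then show ?case using T by simp
  qed
qed

end
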